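(* Let $w\in L^1[0,1]$ be a fixed real function with $w>0$ a.e. on $(0,1)$, let $q\in L^1[0,1]$ be real-valued, and let $\lambda(t,r;q)$, $(t,r)\in(0,1)\times[0,\epsilon_0]$, be the first eigenvalue function of the problem $(\mathbf{E}_q)$. Then the potential $q$ is uniquely determined by $\lambda(t,r;q)$ (that is, if $q_1,q_2\in L^1[0,1]$ satisfy $\lambda(t,r;q_1)=\lambda(t,r;q_2)$ for all $(t,r)\in(0,1)\times[0,\epsilon_0]$, then $q_1=q_2$), and it can be expressed as $$q(x)=\frac{\varphi_0''(x)}{\varphi_0(x)}+\lambda_1 w(x),\qquad \varphi_0(x)=\sqrt{-\frac{\partial\lambda(x,0;q)}{\partial r}},\qquad x\in(0,1),$$ where $\lambda_1$, which equals $\lambda(t,0;q)$, is the first eigenvalue of $(\mathbf{E}_q)$.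
   Context: All potentials and weights are real-valued; identities between $L^1$ functions (in particular the formula for $q(x)$ and $q_1=q_2$) are understood almost everywhere. $(\mathbf{E}_q)$ is the Dirichlet eigenvalue problem $-y''(x)+q(x)y(x)=\lambda w(x)y(x)$ on $[0,1]$, $y(0)=0=y(1)$, with spectral parameter $\lambda$. For $t\in(0,1)$ and $r\ge 0$, $(\mathbf{E}^{t,r}_q)$ is the perturbed Dirichlet problem $-y''(x)+[q(x)-r\delta(x-t)]y(x)=\lambda w(x)y(x)$, $y(0)=0=y(1)$, where $\delta(\cdot-t)$ is the Dirac delta at $t$. It is understood as follows: $y$ is absolutely continuous on $[0,1]$, $y'$ exists and is absolutely continuous on each side of $t$ with one-sided limits $y'(t^\pm)$ at $t$, $-y''+qy=\lambda wy$ holds a.e. for $x\neq t$, $y'(t^-)-y'(t^+)=r\,y(t)$, and $y(0)=0=y(1)$. In particular $(\mathbf{E}^{t,0}_q)$ is $(\mathbf{E}_q)$. $\epsilon_0>0$ is a fixed small enough number. The first eigenvalue function of $(\mathbf{E}_q)$ is the function $(t,r)\mapsto\lambda(t,r;q)$, where $\lambda(t,r;q)$ is the first (smallest) eigenvalue of $(\mathbf{E}^{t,r}_q)$. The derivative $\partial\lambda(x,0;q)/\partial r$ is the right partial derivative with respect to $r$ at $r=0$, with $t=x$. *)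

theory Defs
  imports "HOL-Analysis.Analysis"
begin

(* Absolute continuity in the classical epsilon-delta sense; D is a finite family of
   nonoverlapping subintervals [a,b] of S, encoded as the set of its endpoint pairs (a,b). *)
definition abs_continuous_on :: "real set \<Rightarrow> (real \<Rightarrow> real) \<Rightarrow> bool" where
  "abs_continuous_on S f \<longleftrightarrow>
     (\<forall>e>0. \<exists>d>0. \<forall>D. finite D \<longrightarrow>
        (\<forall>(a, b)\<in>D. a \<le> b \<and> {a..b} \<subseteq> S) \<longrightarrow>
        disjoint_family_on (\<lambda>(a, b). {a<..<b}) D \<longrightarrow>
        (\<Sum>(a, b)\<in>D. b - a) < d \<longrightarrow>
        (\<Sum>(a, b)\<in>D. \<bar>f b - f a\<bar>) < e)"

(* y solves -y'' + q y = l w y a.e. on [0,1], y(0) = 0 = y(1); z is y', one-sided at 0 and 1. *)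
definition dirichlet_solution ::
  "(real \<Rightarrow> real) \<Rightarrow> (real \<Rightarrow> real) \<Rightarrow> real \<Rightarrow> (real \<Rightarrow> real) \<Rightarrow> bool" where
  "dirichlet_solution w q l y \<longleftrightarrow>
     (\<exists>z. abs_continuous_on {0..1} y \<and>
          (\<forall>x\<in>{0..1}. (y has_real_derivative z x) (at x within {0..1})) \<and>
          abs_continuous_on {0..1} z \<and>
          (AE x\<in>{0..1} in lebesgue.
             \<exists>z'. (z has_real_derivative z') (at x) \<and> - z' + q x * y x = l * w x * y x) \<and>
          y 0 = 0 \<and> y 1 = 0)"

definition dirichlet_eigenvalue ::
  "(real \<Rightarrow> real) \<Rightarrow> (real \<Rightarrow> real) \<Rightarrow> real \<Rightarrow> bool" where
  "dirichlet_eigenvalue w q l \<longleftrightarrow>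
     (\<exists>y. dirichlet_solution w q l y \<and> (\<exists>x\<in>{0..1}. y x \<noteq> 0))"

(* The problem with potential q - r delta(. - t): z is y' away from t, and L, R are the one-sided
   limits y'(t-), y'(t+).  The value of z at t itself is irrelevant. *)
definition delta_dirichlet_solution ::
  "(real \<Rightarrow> real) \<Rightarrow> (real \<Rightarrow> real) \<Rightarrow> real \<Rightarrow> real \<Rightarrow> real \<Rightarrow> (real \<Rightarrow> real) \<Rightarrow> bool" where
  "delta_dirichlet_solution w q t r l y \<longleftrightarrow>
     (\<exists>z L R. abs_continuous_on {0..1} y \<and>
          (\<forall>x\<in>{0..1} - {t}. (y has_real_derivative z x) (at x within {0..1})) \<and>
          abs_continuous_on {0..<t} z \<and> abs_continuous_on {t<..1} z \<and>
          (z \<longlongrightarrow> L) (at_left t) \<and> (z \<longlongrightarrow> R) (at_right t) \<and>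
          (AE x\<in>{0..1} in lebesgue.
             \<exists>z'. (z has_real_derivative z') (at x) \<and> - z' + q x * y x = l * w x * y x) \<and>
          L - R = r * y t \<and>
          y 0 = 0 \<and> y 1 = 0)"

definition delta_dirichlet_eigenvalue ::
  "(real \<Rightarrow> real) \<Rightarrow> (real \<Rightarrow> real) \<Rightarrow> real \<Rightarrow> real \<Rightarrow> real \<Rightarrow> bool" where
  "delta_dirichlet_eigenvalue w q t r l \<longleftrightarrow>
     (\<exists>y. delta_dirichlet_solution w q t r l y \<and> (\<exists>x\<in>{0..1}. y x \<noteq> 0))"

(* LEAST on the reals is meaningful only when the set of eigenvalues has a minimum. *)
definition first_dirichlet_eigenvalue :: "(real \<Rightarrow> real) \<Rightarrow> (real \<Rightarrow> real) \<Rightarrow> real" where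
  "first_dirichlet_eigenvalue w q = (LEAST l. dirichlet_eigenvalue w q l)"

definition first_eigenvalue_function ::
  "(real \<Rightarrow> real) \<Rightarrow> (real \<Rightarrow> real) \<Rightarrow> real \<Rightarrow> real \<Rightarrow> real" where
  "first_eigenvalue_function w q t r = (LEAST l. delta_dirichlet_eigenvalue w q t r l)"

definition first_eigenvalue_r_deriv :: "(real \<Rightarrow> real) \<Rightarrow> (real \<Rightarrow> real) \<Rightarrow> real \<Rightarrow> real" where
  "first_eigenvalue_r_deriv w q x =
     vector_derivative (\<lambda>r. first_eigenvalue_function w q x r) (at_right 0)"

definition phi0 :: "(real \<Rightarrow> real) \<Rightarrow> (real \<Rightarrow> real) \<Rightarrow> real \<Rightarrow> real" where
  "phi0 w q x = sqrt (- first_eigenvalue_r_deriv w q x)"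

end

theory Submission
  imports Defs
begin

text \<open>Write \<open>p\<^sub>l = q - l w\<close> and let \<open>\<phi>\<^sub>l\<close>, \<open>\<psi>\<^sub>l\<close> be the solutions of \<open>y'' = p\<^sub>l y\<close> with
  \<open>\<phi>\<^sub>l(0) = 0\<close>, \<open>\<phi>\<^sub>l'(0) = 1\<close> and \<open>\<psi>\<^sub>l(1) = 0\<close>, \<open>\<psi>\<^sub>l'(1) = -1\<close>.
  Their Wronskian \<open>\<phi>\<^sub>l' \<psi>\<^sub>l - \<phi>\<^sub>l \<psi>\<^sub>l'\<close> is the constant \<open>\<phi>\<^sub>l(1)\<close>, so that the Dirichlet eigenvalues
  are the zeros of \<open>l \<mapsto> \<phi>\<^sub>l(1)\<close>.  A solution of the problem with the point interaction at \<open>t\<close> is a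
  multiple of \<open>\<phi>\<^sub>l\<close> on the left and of \<open>\<psi>\<^sub>l\<close> on the right of \<open>t\<close>, and the jump condition turns into the
  characteristic equation \<open>\<phi>\<^sub>l(1) = r \<phi>\<^sub>l(t) \<psi>\<^sub>l(t)\<close>.

  The set of those \<open>l\<close> for which \<open>\<phi>\<^sub>l\<close> is positive on \<open>(0,1]\<close> is nonempty, open to the right, closed
  downwards (Sturm comparison) and bounded above (Picone's identity).  Its supremum \<open>\<lambda>\<^sub>1\<close> is the first
  eigenvalue, and for \<open>l \<le> \<lambda>\<^sub>1\<close> both \<open>\<phi>\<^sub>l\<close> and \<open>\<psi>\<^sub>l\<close> are positive on \<open>(0,1)\<close>.  There the characteristic
  equation reads \<open>c(l) = r\<close> with \<open>c(l) = \<phi>\<^sub>l(1) / (\<phi>\<^sub>l(t) \<psi>\<^sub>l(t)) = \<phi>\<^sub>l'(t)/\<phi>\<^sub>l(t) - \<psi>\<^sub>l'(t)/\<psi>\<^sub>l(t)\<close>, a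
  continuous, strictly decreasing function with \<open>c(\<lambda>\<^sub>1) = 0\<close>.  Hence for small \<open>r > 0\<close> the first eigenvalue
  \<open>\<lambda>(t,r)\<close> is the unique root of \<open>c = r\<close> below \<open>\<lambda>\<^sub>1\<close> (\<open>first_eigenvalue_function_small\<close>).  The Wronskian of
  \<open>\<phi>\<^sub>l\<close> and \<open>\<phi>\<^bsub>\<lambda>\<^sub>1\<^esub>\<close> gives
  \<open>-\<phi>\<^bsub>\<lambda>\<^sub>1\<^esub>'(1) \<phi>\<^sub>l(1) = (\<lambda>\<^sub>1 - l) \<integral> w \<phi>\<^sub>l \<phi>\<^bsub>\<lambda>\<^sub>1\<^esub>\<close>, and so
  \<open>(\<lambda>\<^sub>1 - l) / c(l)\<close> tends to \<open>\<phi>\<^bsub>\<lambda>\<^sub>1\<^esub>(t)\<^sup>2 / \<integral> w \<phi>\<^bsub>\<lambda>\<^sub>1\<^esub>\<^sup>2\<close> as \<open>l\<close> increases to \<open>\<lambda>\<^sub>1\<close>.  This limit is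
  \<open>-\<partial>\<lambda>(t,0)/\<partial>r\<close> (\<open>first_eigenvalue_function_has_derivative\<close>).  Thus \<open>\<phi>\<^sub>0\<close> is the
  positive first eigenfunction with \<open>\<integral> w \<phi>\<^sub>0\<^sup>2 = 1\<close>, and \<open>q\<close> is read off from the equation
  \<open>\<phi>\<^sub>0'' = (q - \<lambda>\<^sub>1 w) \<phi>\<^sub>0\<close>.  Both \<open>\<lambda>\<^sub>1\<close> and \<open>\<phi>\<^sub>0\<close> depend only on the eigenvalue function near \<open>r = 0\<close>,
  which gives uniqueness.

  As \<open>q\<close> and \<open>w\<close> are merely integrable, everything rests on a small calculus of absolutely
  continuous functions with a derivative almost everywhere (\<open>has_ae_deriv\<close>): such a function is
  nondecreasing if its derivative is nonnegative almost everywhere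
  (\<open>ac_AE_deriv_nonneg_imp_le\<close>), and indefinite integrals of integrable functions are of this kind.
  Existence of solutions and their Lipschitz dependence on \<open>l\<close> follow from the contraction principle
  and from Gronwall's inequality with an integrable kernel.\<close>

section \<open>Absolutely continuous functions\<close>

definition nonoverlapping_in :: "real set \<Rightarrow> (real \<times> real) set \<Rightarrow> bool" where
  "nonoverlapping_in S D \<longleftrightarrow> finite D \<and> (\<forall>(u, v)\<in>D. u \<le> v \<and> {u..v} \<subseteq> S) \<and>
     disjoint_family_on (\<lambda>(u, v). {u<..<v}) D"

lemma nonoverlapping_inD:
  assumes "nonoverlapping_in S D" "(u, v) \<in> D"
  shows "u \<le> v" "{u..v} \<subseteq> S" "u \<in> S" "v \<in> S"
  using assms by (fastforce simp: nonoverlapping_in_def)+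

lemma abs_continuous_on_iff:
  "abs_continuous_on S f \<longleftrightarrow>
     (\<forall>e>0. \<exists>d>0. \<forall>D. nonoverlapping_in S D \<longrightarrow> (\<Sum>(u, v)\<in>D. v - u) < d \<longrightarrow>
        (\<Sum>(u, v)\<in>D. \<bar>f v - f u\<bar>) < e)"
  unfolding abs_continuous_on_def nonoverlapping_in_def by (simp only: imp_conjL)

lemma abs_continuous_onE:
  assumes "abs_continuous_on S f" "e > 0"
  obtains d where "d > 0"
    "\<And>D. nonoverlapping_in S D \<Longrightarrow> (\<Sum>(u, v)\<in>D. v - u) < d \<Longrightarrow> (\<Sum>(u, v)\<in>D. \<bar>f v - f u\<bar>) < e"
  using assms unfolding abs_continuous_on_iff by blast

lemma abs_continuous_on_subset:
  assumes "abs_continuous_on T f" "S \<subseteq> T"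
  shows "abs_continuous_on S f"
  unfolding abs_continuous_on_iff
proof (intro allI impI)
  fix e :: real assume "e > 0"
  then obtain d where "d > 0" and d:
    "\<And>D. nonoverlapping_in T D \<Longrightarrow> (\<Sum>(u, v)\<in>D. v - u) < d \<Longrightarrow> (\<Sum>(u, v)\<in>D. \<bar>f v - f u\<bar>) < e"
    using abs_continuous_onE[OF assms(1)] by blast
  show "\<exists>d>0. \<forall>D. nonoverlapping_in S D \<longrightarrow> (\<Sum>(a, b)\<in>D. b - a) < d \<longrightarrow>
        (\<Sum>(a, b)\<in>D. \<bar>f b - f a\<bar>) < e"
    using \<open>d > 0\<close> assms(2) by (intro exI[of _ d] conjI allI impI d) (fastforce simp: nonoverlapping_in_def)+
qed

text \<open>The closure properties below all come from one principle: a function whose increments are bounded by a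
  fixed multiple of those of absolutely continuous functions is itself absolutely continuous.\<close>

lemma abs_continuous_on_dominated2:
  assumes f: "abs_continuous_on S f" and g: "abs_continuous_on S g" and "C > 0"
    and dom: "\<And>u v. \<lbrakk>u \<in> S; v \<in> S; u \<le> v\<rbrakk> \<Longrightarrow> \<bar>h v - h u\<bar> \<le> C * (\<bar>f v - f u\<bar> + \<bar>g v - g u\<bar>)"
  shows "abs_continuous_on S h"
  unfolding abs_continuous_on_iff
proof (intro allI impI)
  fix e :: real assume "e > 0"
  then have e': "e / (2 * C) > 0" using \<open>C > 0\<close> by simp
  obtain d1 where "d1 > 0" and d1:
    "\<And>D. nonoverlapping_in S D \<Longrightarrow> (\<Sum>(u, v)\<in>D. v - u) < d1 \<Longrightarrow> (\<Sum>(u, v)\<in>D. \<bar>f v - f u\<bar>) < e / (2 * C)"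
    using abs_continuous_onE[OF f e'] by blast
  obtain d2 where "d2 > 0" and d2:
    "\<And>D. nonoverlapping_in S D \<Longrightarrow> (\<Sum>(u, v)\<in>D. v - u) < d2 \<Longrightarrow> (\<Sum>(u, v)\<in>D. \<bar>g v - g u\<bar>) < e / (2 * C)"
    using abs_continuous_onE[OF g e'] by blast
  have "(\<Sum>(u, v)\<in>D. \<bar>h v - h u\<bar>) < e"
    if D: "nonoverlapping_in S D" "(\<Sum>(u, v)\<in>D. v - u) < min d1 d2" for D
  proof -
    have "(\<Sum>(u, v)\<in>D. \<bar>h v - h u\<bar>)
        \<le> (\<Sum>(u, v)\<in>D. C * (\<bar>f v - f u\<bar> + \<bar>g v - g u\<bar>))"
      by (intro sum_mono) (use nonoverlapping_inD[OF D(1)] in \<open>auto intro!: dom\<close>)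
    also have "\<dots> = C * (\<Sum>(u, v)\<in>D. \<bar>f v - f u\<bar>) + C * (\<Sum>(u, v)\<in>D. \<bar>g v - g u\<bar>)"
      by (simp add: sum_distrib_left case_prod_unfold distrib_left sum.distrib)
    also have "\<dots> < C * (e / (2 * C)) + C * (e / (2 * C))"
      using D \<open>C > 0\<close> by (intro add_strict_mono mult_strict_left_mono d1 d2) auto
    also have "\<dots> = e" using \<open>C > 0\<close> by (simp add: field_simps)
    finally show ?thesis .
  qed
  then show "\<exists>d>0. \<forall>D. nonoverlapping_in S D \<longrightarrow> (\<Sum>(a, b)\<in>D. b - a) < d \<longrightarrow>
        (\<Sum>(a, b)\<in>D. \<bar>h b - h a\<bar>) < e"
    using \<open>d1 > 0\<close> \<open>d2 > 0\<close> by (intro exI[of _ "min d1 d2"]) auto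
qed

lemma abs_continuous_on_dominated:
  assumes f: "abs_continuous_on S f" and "C > 0"
    and dom: "\<And>u v. \<lbrakk>u \<in> S; v \<in> S; u \<le> v\<rbrakk> \<Longrightarrow> \<bar>h v - h u\<bar> \<le> C * \<bar>f v - f u\<bar>"
  shows "abs_continuous_on S h"
proof (rule abs_continuous_on_dominated2[OF f f \<open>C > 0\<close>])
  fix u v assume "u \<in> S" "v \<in> S" "u \<le> v"
  then have "\<bar>h v - h u\<bar> \<le> C * \<bar>f v - f u\<bar>" by (rule dom)
  also have "\<dots> \<le> C * (\<bar>f v - f u\<bar> + \<bar>f v - f u\<bar>)" using \<open>C > 0\<close> by simp
  finally show "\<bar>h v - h u\<bar> \<le> C * (\<bar>f v - f u\<bar> + \<bar>f v - f u\<bar>)" .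
qed

lemma abs_continuous_on_id: "abs_continuous_on S (\<lambda>x. x)"
  unfolding abs_continuous_on_iff
proof (intro allI impI)
  fix e :: real assume "e > 0"
  have "(\<Sum>(u, v)\<in>D. \<bar>v - u\<bar>) < e"
    if "nonoverlapping_in S D" "(\<Sum>(u, v)\<in>D. v - u) < e" for D
  proof -
    have "(\<Sum>(u, v)\<in>D. \<bar>v - u\<bar>) = (\<Sum>(u, v)\<in>D. v - u)"
      using nonoverlapping_inD[OF that(1)] by (intro sum.cong) auto
    with that(2) show ?thesis by simp
  qed
  then show "\<exists>d>0. \<forall>D. nonoverlapping_in S D \<longrightarrow> (\<Sum>(a, b)\<in>D. b - a) < d \<longrightarrow>
        (\<Sum>(a, b)\<in>D. \<bar>b - a\<bar>) < e"
    using \<open>e > 0\<close> by (intro exI[of _ e]) auto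
qed

lemma abs_continuous_on_lipschitz:
  assumes "\<And>u v. \<lbrakk>u \<in> S; v \<in> S; u \<le> v\<rbrakk> \<Longrightarrow> \<bar>h v - h u\<bar> \<le> C * \<bar>v - u\<bar>"
  shows "abs_continuous_on S h"
proof (rule abs_continuous_on_dominated[OF abs_continuous_on_id])
  show "max C 1 > 0" by simp
  show "\<bar>h v - h u\<bar> \<le> max C 1 * \<bar>v - u\<bar>" if "u \<in> S" "v \<in> S" "u \<le> v" for u v
    using assms[OF that] mult_right_mono[of C "max C 1" "\<bar>v - u\<bar>"] by linarith
qed

lemma abs_continuous_on_cong:
  assumes "abs_continuous_on S f" "\<And>x. x \<in> S \<Longrightarrow> f x = g x"
  shows "abs_continuous_on S g"
  by (rule abs_continuous_on_dominated[OF assms(1), of 1]) (use assms(2) in auto)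

lemma abs_continuous_on_imp_continuous_on:
  assumes "abs_continuous_on {a..b} f"
  shows "continuous_on {a..b} f"
  unfolding continuous_on_iff
proof (intro ballI allI impI)
  fix x e :: real assume x: "x \<in> {a..b}" and "e > 0"
  obtain d where "d > 0" and d:
    "\<And>D. nonoverlapping_in {a..b} D \<Longrightarrow> (\<Sum>(u, v)\<in>D. v - u) < d \<Longrightarrow> (\<Sum>(u, v)\<in>D. \<bar>f v - f u\<bar>) < e"
    using abs_continuous_onE[OF assms \<open>e > 0\<close>] by blast
  have "dist (f y) (f x) < e" if y: "y \<in> {a..b}" "dist y x < d" for y
    using d[of "{(min x y, max x y)}"] x y
    by (auto simp: nonoverlapping_in_def disjoint_family_on_def dist_real_def abs_if min_def max_def split: if_splits)
  then show "\<exists>d>0. \<forall>y\<in>{a..b}. dist y x < d \<longrightarrow> dist (f y) (f x) < e"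
    using \<open>d > 0\<close> by blast
qed

lemma abs_continuous_on_bounded:
  assumes "abs_continuous_on {a..b} f"
  obtains B where "B > 0" "\<And>x. x \<in> {a..b} \<Longrightarrow> \<bar>f x\<bar> \<le> B"
proof -
  have "bounded (f ` {a..b})"
    by (intro compact_imp_bounded compact_continuous_image
        abs_continuous_on_imp_continuous_on[OF assms] compact_Icc)
  then show thesis using that by (auto simp: bounded_pos)
qed

lemma abs_continuous_on_diff:
  assumes "abs_continuous_on S f" "abs_continuous_on S g"
  shows "abs_continuous_on S (\<lambda>x. f x - g x)"
  by (rule abs_continuous_on_dominated2[OF assms, of 1]) auto

lemma abs_continuous_on_mult:
  assumes "abs_continuous_on {a..b} f" "abs_continuous_on {a..b} g"
  shows "abs_continuous_on {a..b} (\<lambda>x. f x * g x)"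
proof -
  obtain A where A: "A > 0" "\<And>x. x \<in> {a..b} \<Longrightarrow> \<bar>f x\<bar> \<le> A"
    using abs_continuous_on_bounded[OF assms(1)] by blast
  obtain B where B: "B > 0" "\<And>x. x \<in> {a..b} \<Longrightarrow> \<bar>g x\<bar> \<le> B"
    using abs_continuous_on_bounded[OF assms(2)] by blast
  show ?thesis
  proof (rule abs_continuous_on_dominated2[OF assms, of "A + B"])
    fix u v assume uv: "u \<in> {a..b}" "v \<in> {a..b}"
    have "f v * g v - f u * g u = f v * (g v - g u) + g u * (f v - f u)" by algebra
    then have "\<bar>f v * g v - f u * g u\<bar> \<le> \<bar>f v\<bar> * \<bar>g v - g u\<bar> + \<bar>g u\<bar> * \<bar>f v - f u\<bar>"
      by (metis abs_mult abs_triangle_ineq)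
    also have "\<dots> \<le> (A + B) * \<bar>g v - g u\<bar> + (A + B) * \<bar>f v - f u\<bar>"
      using A(1) B(1) A(2)[OF uv(2)] B(2)[OF uv(1)] by (intro add_mono mult_right_mono) auto
    finally show "\<bar>f v * g v - f u * g u\<bar> \<le> (A + B) * (\<bar>f v - f u\<bar> + \<bar>g v - g u\<bar>)"
      by (simp add: algebra_simps)
  qed (use A(1) B(1) in simp)
qed

lemma abs_continuous_on_inverse:
  assumes f: "abs_continuous_on {a..b} f" and pos: "\<And>x. x \<in> {a..b} \<Longrightarrow> f x > 0"
  shows "abs_continuous_on {a..b} (\<lambda>x. inverse (f x))"
proof (cases "a \<le> b")
  case True
  obtain x0 where x0: "x0 \<in> {a..b}" "\<And>x. x \<in> {a..b} \<Longrightarrow> f x0 \<le> f x"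
    using continuous_attains_inf[OF compact_Icc _ abs_continuous_on_imp_continuous_on[OF f]] True
    by fastforce
  define c where "c = f x0"
  have c: "c > 0" "\<And>x. x \<in> {a..b} \<Longrightarrow> c \<le> f x" using x0 pos by (auto simp: c_def)
  show ?thesis
  proof (rule abs_continuous_on_dominated[OF f, of "1 / (c * c)"])
    fix u v assume uv: "u \<in> {a..b}" "v \<in> {a..b}"
    have "\<bar>inverse (f v) - inverse (f u)\<bar> = \<bar>f v - f u\<bar> / (f u * f v)"
      using pos[OF uv(1)] pos[OF uv(2)] by (simp add: field_simps abs_if)
    also have "\<dots> \<le> \<bar>f v - f u\<bar> / (c * c)"
      using c(1) c(2)[OF uv(1)] c(2)[OF uv(2)] by (intro divide_left_mono mult_mono) auto
    finally show "\<bar>inverse (f v) - inverse (f u)\<bar> \<le> 1 / (c * c) * \<bar>f v - f u\<bar>" by simp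
  qed (use c in simp)
qed (auto intro: abs_continuous_on_lipschitz)

text \<open>An absolutely continuous function on a compact interval is bounded by some \<open>B\<close>, and the exponential
  function is Lipschitz with constant \<open>exp B\<close> below \<open>B\<close>.\<close>

lemma abs_continuous_on_exp:
  assumes f: "abs_continuous_on {a..b} f"
  shows "abs_continuous_on {a..b} (\<lambda>x. exp (f x))"
proof -
  obtain B where B: "B > 0" "\<And>x. x \<in> {a..b} \<Longrightarrow> \<bar>f x\<bar> \<le> B"
    using abs_continuous_on_bounded[OF f] by blast
  have *: "exp s - exp r \<le> exp B * (s - r)" if "r \<le> s" "s \<le> B" for r s :: real
  proof -
    have "1 + (r - s) \<le> exp (r - s)" by (rule exp_ge_add_one_self)
    then have "exp s * (1 + (r - s)) \<le> exp s * exp (r - s)" by (intro mult_left_mono) auto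
    then have "exp s - exp r \<le> exp s * (s - r)" by (simp add: algebra_simps flip: exp_add)
    also have "\<dots> \<le> exp B * (s - r)" using that by (intro mult_right_mono) auto
    finally show ?thesis .
  qed
  show ?thesis
  proof (rule abs_continuous_on_dominated[OF f, of "exp B"])
    fix u v assume "u \<in> {a..b}" "v \<in> {a..b}"
    then have "f u \<le> B" "f v \<le> B" using B(2) abs_le_D1 by blast+
    then show "\<bar>exp (f v) - exp (f u)\<bar> \<le> exp B * \<bar>f v - f u\<bar>"
      using *[of "f u" "f v"] *[of "f v" "f u"] by (cases "f u \<le> f v") (auto simp: abs_if not_le)
  qed simp
qed

text \<open>A Cousin covering argument.  Let \<open>N\<close> be the null set of points without a nonnegative derivative, covered
  by an open set \<open>U\<close> of small measure.  A tagged division is chosen so fine that an interval with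
  its tag outside \<open>N\<close> has \<open>f v - f u \<ge> -e' (v - u)\<close>, and one with its tag in \<open>N\<close> is contained in \<open>U\<close>.  The
  latter intervals have small total length, so absolute continuity bounds their total increment.\<close>

lemma ac_AE_deriv_nonneg_imp_le:
  assumes "a \<le> b" and ac: "abs_continuous_on {a..b} f"
    and deriv: "AE x\<in>{a..b} in lebesgue. \<exists>D\<ge>0. (f has_real_derivative D) (at x)"
  shows "f a \<le> f b"
proof (rule field_le_epsilon)
  fix e :: real assume "e > 0"
  define e' where "e' = e / (2 * (b - a + 1))"
  have "e' > 0" using \<open>e > 0\<close> \<open>a \<le> b\<close> by (simp add: e'_def)
  obtain d where "d > 0" and d:
    "\<And>D. nonoverlapping_in {a..b} D \<Longrightarrow> (\<Sum>(u, v)\<in>D. v - u) < d \<Longrightarrow> (\<Sum>(u, v)\<in>D. \<bar>f v - f u\<bar>) < e / 2"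
    using abs_continuous_onE[OF ac half_gt_zero[OF \<open>e > 0\<close>]] by blast
  define N where "N = {x \<in> {a..b}. \<not> (\<exists>D\<ge>0. (f has_real_derivative D) (at x))}"
  from deriv obtain N' where "N \<subseteq> N'" "N' \<in> null_sets lebesgue"
    unfolding eventually_ae_filter N_def by auto
  obtain U where U: "open U" "N' \<subseteq> U" "emeasure lebesgue (U - N') < ennreal d"
    using sets_lebesgue_outer_open[of N' d] \<open>N' \<in> null_sets lebesgue\<close> \<open>d > 0\<close> by blast
  have U_less: "emeasure lebesgue U < ennreal d"
  proof -
    have "emeasure lebesgue (U - N') = emeasure lebesgue U"
      using \<open>open U\<close> \<open>N' \<in> null_sets lebesgue\<close> by (intro emeasure_Diff_null_set) auto
    with U(3) show ?thesis by simp
  qed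
  have "\<exists>g>0. x \<in> {a..b} - N \<longrightarrow>
          (\<forall>u v. u \<le> x \<and> x \<le> v \<and> u \<in> ball x g \<and> v \<in> ball x g \<longrightarrow> f v - f u \<ge> - e' * (v - u))" for x
  proof (cases "x \<in> {a..b} - N")
    case True
    then obtain D where "D \<ge> 0" and D: "(f has_real_derivative D) (at x)" by (auto simp: N_def)
    from D obtain g where "g > 0" and g: "\<And>y. \<bar>y - x\<bar> < g \<Longrightarrow> \<bar>f y - f x - D * (y - x)\<bar> \<le> e' * \<bar>y - x\<bar>"
      unfolding has_field_derivative_def has_derivative_within_alt using \<open>e' > 0\<close> by force
    have "f v - f u \<ge> - e' * (v - u)" if "u \<le> x" "x \<le> v" "u \<in> ball x g" "v \<in> ball x g" for u v
    proof -
      have "\<bar>f v - f x - D * (v - x)\<bar> \<le> e' * (v - x)" "\<bar>f u - f x - D * (u - x)\<bar> \<le> e' * (x - u)"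
        using g[of v] g[of u] that by (auto simp: dist_real_def)
      moreover have "D * (v - x) \<ge> 0" "D * (x - u) \<ge> 0" using that \<open>D \<ge> 0\<close> by auto
      ultimately show ?thesis by (simp add: algebra_simps)
    qed
    with \<open>g > 0\<close> show ?thesis by blast
  qed (auto intro: exI[of _ 1])
  then have "\<forall>x. \<exists>g. 0 < g \<and> (x \<in> {a..b} - N \<longrightarrow>
          (\<forall>u v. u \<le> x \<and> x \<le> v \<and> u \<in> ball x g \<and> v \<in> ball x g \<longrightarrow> f v - f u \<ge> - e' * (v - u)))"
    by blast
  from choice[OF this] obtain g where g: "\<And>x. 0 < g x"
    "\<And>x u v. \<lbrakk>x \<in> {a..b}; x \<notin> N; u \<le> x; x \<le> v; u \<in> ball x (g x); v \<in> ball x (g x)\<rbrakk>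
          \<Longrightarrow> f v - f u \<ge> - e' * (v - u)"
    by blast
  define G where "G = (\<lambda>x. if x \<in> N then U else ball x (g x))"
  have "gauge G"
    unfolding gauge_def G_def using g(1) U \<open>N \<subseteq> N'\<close> by auto
  then obtain p where p: "p tagged_division_of {a..b}" "G fine p"
    using fine_division_exists_real by blast
  have fin: "finite p" using p(1) by blast
  have K: "\<exists>u v. K = {u..v} \<and> u \<le> x \<and> x \<le> v \<and> Inf K = u \<and> Sup K = v \<and> a \<le> u \<and> v \<le> b \<and> x \<in> {a..b} \<and> {u..v} \<subseteq> G x"
    if xK: "(x, K) \<in> p" for x K
  proof -
    obtain u v where uv: "K = cbox u v" using tagged_division_ofD(4)[OF p(1) xK] by blast
    have "x \<in> K" "K \<subseteq> {a..b}" using xK p(1) by blast+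
    moreover have "K \<subseteq> G x" using p(2) xK by (auto simp: fine_def)
    ultimately show ?thesis using uv by (intro exI[of _ u] exI[of _ v]) auto
  qed
  \<comment> \<open>Two tags can share an interval only if it is degenerate; the increment there is zero, and leaving
    such intervals out makes the family of endpoint pairs injectively indexed.\<close>
  define p1 where "p1 = {(x, K) \<in> p. x \<in> N \<and> Inf K < Sup K}"
  have p1: "p1 \<subseteq> p" "finite p1" using fin by (auto simp: p1_def intro: finite_subset)
  define D where "D = (\<lambda>(x, K). (Inf K, Sup K)) ` p1"
  have disjK: "interior K \<inter> interior K' = {}" if "(x, K) \<in> p" "(x', K') \<in> p" "(x, K) \<noteq> (x', K')" for x K x' K'
    using that p(1) by (meson tagged_division_ofD(5))
  have inj: "inj_on (\<lambda>(x, K). (Inf K, Sup K)) p1"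
  proof (rule inj_onI, clarify)
    fix x K x' K' assume *: "(x, K) \<in> p1" "(x', K') \<in> p1" "Inf K = Inf K'" "Sup K = Sup K'"
    then have "(x, K) \<in> p" "(x', K') \<in> p" "Inf K < Sup K" by (auto simp: p1_def)
    then have "K = {Inf K..Sup K}" "K' = {Inf K..Sup K}" using K *(3,4) by metis+
    then have "interior K \<inter> interior K' = {Inf K<..<Sup K}" by (metis interior_atLeastAtMost_real inf.idem)
    then show "x = x' \<and> K = K'" 
      using disjK[OF \<open>(x, K) \<in> p\<close> \<open>(x', K') \<in> p\<close>] \<open>Inf K < Sup K\<close> by auto
  qed
  have dj: "disjoint_family_on (\<lambda>(u, v). {u<..<v}) D"
    unfolding disjoint_family_on_def
  proof (intro ballI impI)
    fix m n assume "m \<in> D" "n \<in> D" "m \<noteq> n"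
    then obtain x K x' K' where *: "(x, K) \<in> p" "(x', K') \<in> p" "m = (Inf K, Sup K)" "n = (Inf K', Sup K')"
      unfolding D_def p1_def by auto
    then have "(x, K) \<noteq> (x', K')" using \<open>m \<noteq> n\<close> by auto
    then have "interior K \<inter> interior K' = {}" using disjK * by blast
    moreover have "K = {Inf K..Sup K}" "K' = {Inf K'..Sup K'}" using K *(1,2) by metis+
    ultimately have "{Inf K<..<Sup K} \<inter> {Inf K'<..<Sup K'} = {}" by (metis interior_atLeastAtMost_real)
    then show "(case m of (u, v) \<Rightarrow> {u<..<v}) \<inter> (case n of (u, v) \<Rightarrow> {u<..<v}) = {}" using *(3,4) by simp
  qed
  have Dsub: "u \<le> v \<and> {u..v} \<subseteq> {a..b} \<and> {u..v} \<subseteq> U" if uv: "(u, v) \<in> D" for u v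
  proof -
    obtain x K where *: "(x, K) \<in> p" "x \<in> N" "u = Inf K" "v = Sup K"
      using uv by (auto simp: D_def p1_def)
    then show ?thesis using K[OF *(1)] by (force simp: G_def)
  qed
  have finD: "finite D" using p1 by (simp add: D_def)
  have "ennreal (\<Sum>(u, v)\<in>D. v - u) = (\<Sum>m\<in>D. emeasure lebesgue (case m of (u, v) \<Rightarrow> {u<..<v}))"
  proof -
    have "ennreal (\<Sum>(u, v)\<in>D. v - u) = (\<Sum>m\<in>D. ennreal (case m of (u, v) \<Rightarrow> v - u))"
      using Dsub by (intro sum_ennreal[symmetric]) auto
    also have "\<dots> = (\<Sum>m\<in>D. emeasure lebesgue (case m of (u, v) \<Rightarrow> {u<..<v}))"
      using Dsub by (intro sum.cong) auto
    finally show ?thesis .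
  qed
  also have "\<dots> = emeasure lebesgue (\<Union>m\<in>D. case m of (u, v) \<Rightarrow> {u<..<v})"
    using dj finD by (intro sum_emeasure) auto
  also have "\<dots> \<le> emeasure lebesgue U"
    using Dsub U(1) by (intro emeasure_mono) (fastforce simp: subset_iff)+
  also note U_less
  finally have "(\<Sum>(u, v)\<in>D. v - u) < d" using \<open>d > 0\<close> by (simp add: ennreal_less_iff sum_nonneg Dsub case_prod_beta)
  then have "(\<Sum>(u, v)\<in>D. \<bar>f v - f u\<bar>) < e / 2"
    using Dsub finD dj by (intro d) (auto simp: nonoverlapping_in_def)
  then have sum1: "(\<Sum>(x, K)\<in>p1. \<bar>f (Sup K) - f (Inf K)\<bar>) < e / 2"
    unfolding D_def by (subst (asm) sum.reindex[OF inj]) (simp add: case_prod_unfold)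
  have "(\<Sum>(x, K)\<in>p. f (Sup K) - f (Inf K)) \<ge>
        (\<Sum>(x, K)\<in>p. - e' * (Sup K - Inf K)) - (\<Sum>(x, K)\<in>p1. \<bar>f (Sup K) - f (Inf K)\<bar>)"
  proof -
    have "(\<Sum>(x, K)\<in>p. - e' * (Sup K - Inf K) - (if (x, K) \<in> p1 then \<bar>f (Sup K) - f (Inf K)\<bar> else 0))
        \<le> (\<Sum>(x, K)\<in>p. f (Sup K) - f (Inf K))"
    proof (rule sum_mono, clarify)
      fix x K assume xK: "(x, K) \<in> p"
      obtain u v where uv: "K = {u..v}" "u \<le> x" "x \<le> v" "Inf K = u" "Sup K = v" "x \<in> {a..b}" "{u..v} \<subseteq> G x"
        using K[OF xK] by blast
      show "- e' * (Sup K - Inf K) - (if (x, K) \<in> p1 then \<bar>f (Sup K) - f (Inf K)\<bar> else 0) \<le> f (Sup K) - f (Inf K)"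
      proof (cases "(x, K) \<in> p1")
        case True
        have "e' * (v - u) \<ge> 0" using uv \<open>e' > 0\<close> by auto
        then show ?thesis using True uv(4,5) by (simp add: abs_if algebra_simps)
      next
        case False
        then consider "u = v" | "x \<notin> N" using xK uv by (force simp: p1_def)
        then show ?thesis
        proof cases
          case 2
          then have "{u..v} \<subseteq> ball x (g x)" using uv by (simp add: G_def)
          moreover have "u \<in> {u..v}" "v \<in> {u..v}" using uv by auto
          ultimately have "u \<in> ball x (g x)" "v \<in> ball x (g x)" by blast+
          then show ?thesis using False uv g(2)[of x u v] 2 by simp
        qed (use False uv in auto)
      qed
    qed
    moreover have "(\<Sum>(x, K)\<in>p. - e' * (Sup K - Inf K) - (if (x, K) \<in> p1 then \<bar>f (Sup K) - f (Inf K)\<bar> else 0))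
       = (\<Sum>(x, K)\<in>p. - e' * (Sup K - Inf K)) - (\<Sum>(x, K)\<in>p. (if (x, K) \<in> p1 then \<bar>f (Sup K) - f (Inf K)\<bar> else 0))"
      by (simp add: case_prod_unfold sum_subtractf)
    moreover have "(\<Sum>(x, K)\<in>p. (if (x, K) \<in> p1 then \<bar>f (Sup K) - f (Inf K)\<bar> else 0))
       = (\<Sum>(x, K)\<in>p1. \<bar>f (Sup K) - f (Inf K)\<bar>)"
      using sum.inter_restrict[OF fin, of "\<lambda>m. \<bar>f (Sup (snd m)) - f (Inf (snd m))\<bar>" p1] p1(1)
      by (simp add: Int_absorb1 case_prod_unfold)
    ultimately show ?thesis by linarith
  qed
  moreover have "(\<Sum>(x, K)\<in>p. f (Sup K) - f (Inf K)) = f b - f a"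
    using additive_tagged_division_1[OF \<open>a \<le> b\<close> p(1)] .
  moreover have "(\<Sum>(x, K)\<in>p. - e' * (Sup K - Inf K)) = - e' * (b - a)"
    using additive_tagged_division_1[OF \<open>a \<le> b\<close> p(1), of "\<lambda>x. - e' * x"]
    by (simp add: case_prod_unfold algebra_simps)
  moreover have "e' * (b - a) \<le> e / 2"
  proof -
    have "e' * (b - a) = e / 2 * ((b - a) / (b - a + 1))" by (simp add: e'_def)
    also have "\<dots> \<le> e / 2 * 1" using \<open>e > 0\<close> \<open>a \<le> b\<close> by (intro mult_left_mono) auto
    finally show ?thesis by simp
  qed
  ultimately show "f a \<le> f b + e" using sum1 by linarith
qed

section \<open>Indefinite integrals\<close>

lemma AE_lebesgue_notin_finite:
  fixes S :: "real set"
  assumes "finite S"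
  shows "AE x in lebesgue. x \<notin> S"
  using assms by (intro AE_not_in) (simp add: negligible_finite flip: negligible_iff_null_sets)

lemma absolutely_integrable_continuous_mult:
  fixes f g :: "real \<Rightarrow> real"
  assumes f: "f absolutely_integrable_on {a..b}" and g: "continuous_on {a..b} g"
  shows "(\<lambda>x. f x * g x) absolutely_integrable_on {a..b}"
proof -
  have "(\<lambda>x. g x * f x) absolutely_integrable_on {a..b}"
  proof (rule absolutely_integrable_bounded_measurable_product_real)
    show "g \<in> borel_measurable (lebesgue_on {a..b})"
      by (intro continuous_imp_measurable_on_sets_lebesgue g) auto
    show "bounded (g ` {a..b})"
      by (intro compact_imp_bounded compact_continuous_image g compact_Icc)
  qed (use f in auto)
  then show ?thesis by (simp add: mult.commute)
qed

lemma absolutely_integrable_excess: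
  fixes f w :: "real \<Rightarrow> real"
  assumes "f absolutely_integrable_on {a..b}" "w absolutely_integrable_on {a..b}"
  shows "(\<lambda>x. max 0 (\<bar>f x\<bar> - c * w x)) absolutely_integrable_on {a..b}"
  by (intro absolutely_integrable_max_1 set_integral_diff set_integrable_abs
      set_integrable_mult_right assms) auto

text \<open>Dominated convergence: as \<open>n\<close> grows, the excess of \<open>\<bar>f\<bar>\<close> over \<open>n w\<close> decreases to zero wherever \<open>w\<close>
  is positive.  With \<open>w = 1\<close> this is truncation, which yields absolute continuity of the integral; with \<open>w\<close>
  the weight it shows that the potential is dominated by a large multiple of the weight up to a small
  error; with \<open>f = 1\<close> it shows that the integral of a function that is positive almost everywhere is positive.\<close>

lemma integral_excess_small:
  fixes f w :: "real \<Rightarrow> real"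
  assumes f: "f absolutely_integrable_on {a..b}" and w: "w absolutely_integrable_on {a..b}"
    and pos: "AE x\<in>{a..b} in lebesgue. 0 < w x" and "e > 0"
  obtains n :: nat where "integral {a..b} (\<lambda>x. max 0 (\<bar>f x\<bar> - real n * w x)) < e"
proof -
  let ?M = "lebesgue_on {a..b}"
  let ?k = "\<lambda>n x. max 0 (\<bar>f x\<bar> - real n * w x)"
  have meas: "f \<in> borel_measurable ?M" "w \<in> borel_measurable ?M"
    using f w by (auto intro!: absolutely_integrable_imp_borel_measurable)
  have pos': "AE x in ?M. 0 < w x" using pos by (simp add: AE_restrict_space_iff)
  have "(\<lambda>n. integral\<^sup>L ?M (?k n)) \<longlonglongrightarrow> integral\<^sup>L ?M (\<lambda>x. 0)"
  proof (rule integral_dominated_convergence[where w = "\<lambda>x. \<bar>f x\<bar>"])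
    show "integrable ?M (\<lambda>x. \<bar>f x\<bar>)"
      using f by (simp add: absolutely_integrable_on_iff_nonneg set_integrable_def integrable_restrict_space)
    show "AE x in ?M. (\<lambda>n. ?k n x) \<longlonglongrightarrow> 0"
      using pos'
    proof eventually_elim
      case (elim x)
      obtain m :: nat where m: "\<bar>f x\<bar> < real m * w x" using reals_Archimedean3[OF elim] by blast
      have "?k n x = 0" if "n \<ge> m" for n
      proof -
        have "real m * w x \<le> real n * w x" using that elim by (intro mult_right_mono) auto
        with m show ?thesis by simp
      qed
      then show ?case
        by (intro tendsto_eventually) (auto simp: eventually_sequentially)
    qed
    show "AE x in ?M. norm (?k n x) \<le> \<bar>f x\<bar>" for n
      using pos' by eventually_elim auto
  qed (use meas in measurable)
  then have "eventually (\<lambda>n. integral\<^sup>L ?M (?k n) < e) sequentially"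
    using \<open>e > 0\<close> by (intro order_tendstoD) auto
  then obtain n where "integral\<^sup>L ?M (?k n) < e" by (auto simp: eventually_sequentially)
  moreover have "integral\<^sup>L ?M (?k n) = integral {a..b} (?k n)"
    using absolutely_integrable_excess[OF f w, of "real n"]
    by (intro lebesgue_integral_eq_integral)
      (simp_all add: set_integrable_def integrable_restrict_space)
  ultimately show thesis using that by auto
qed

lemma sum_integral_nonoverlapping_le:
  fixes k :: "real \<Rightarrow> real"
  assumes k: "k integrable_on {a..b}" "\<And>x. x \<in> {a..b} \<Longrightarrow> 0 \<le> k x" and D: "nonoverlapping_in {a..b} D"
  shows "(\<Sum>(u, v)\<in>D. integral {u..v} k) \<le> integral {a..b} k"
proof (rule has_integral_subset_le)
  have "(k has_integral (\<Sum>m\<in>D. case m of (u, v) \<Rightarrow> integral {u..v} k)) (\<Union>m\<in>D. case m of (u, v) \<Rightarrow> {u<..<v})"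
  proof (rule has_integral_UN)
    show "(k has_integral (case m of (u, v) \<Rightarrow> integral {u..v} k)) (case m of (u, v) \<Rightarrow> {u<..<v})" if "m \<in> D" for m
    proof (cases m)
      case (Pair u v)
      then have "k integrable_on {u..v}"
        using nonoverlapping_inD(2)[OF D] that k(1) integrable_on_subinterval by blast
      then have "(k has_integral integral {u..v} k) {u..v}" by (rule integrable_integral)
      then show ?thesis using Pair by (simp add: has_integral_Icc_iff_Ioo)
    qed
    show "pairwise (\<lambda>m m'. negligible ((case m of (u, v) \<Rightarrow> {u<..<v}) \<inter> (case m' of (u, v) \<Rightarrow> {u<..<v}))) D"
      using D unfolding pairwise_def nonoverlapping_in_def disjoint_family_on_def by (metis negligible_empty)
  qed (use D in \<open>simp add: nonoverlapping_in_def\<close>)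
  then show "(k has_integral (\<Sum>(u, v)\<in>D. integral {u..v} k)) (\<Union>m\<in>D. case m of (u, v) \<Rightarrow> {u<..<v})" .
  show "(\<Union>m\<in>D. case m of (u, v) \<Rightarrow> {u<..<v}) \<subseteq> {a..b}"
    using nonoverlapping_inD(2)[OF D] by fastforce
qed (use k in auto)

lemma integral_diff_eq:
  fixes f :: "real \<Rightarrow> real"
  assumes "f integrable_on {a..b}" "a \<le> u" "u \<le> v" "v \<le> b"
  shows "integral {a..v} f - integral {a..u} f = integral {u..v} f"
  using Henstock_Kurzweil_Integration.integral_combine[where a = a and c = u and b = v and f = f] integrable_on_subinterval[of f "{a..b}" a v] assms by simp

lemma abs_continuous_on_integral:
  fixes f :: "real \<Rightarrow> real"
  assumes f: "f absolutely_integrable_on {a..b}"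
  shows "abs_continuous_on {a..b} (\<lambda>x. integral {a..x} f)"
  unfolding abs_continuous_on_iff
proof (intro allI impI)
  fix e :: real assume "e > 0"
  obtain n :: nat where n: "integral {a..b} (\<lambda>x. max 0 (\<bar>f x\<bar> - real n * 1)) < e / 2"
    using integral_excess_small[OF f, of "\<lambda>x. 1" "e / 2"] \<open>e > 0\<close> by auto
  define k where "k = (\<lambda>x. max 0 (\<bar>f x\<bar> - real n * 1))"
  have kai: "k absolutely_integrable_on {a..b}"
    unfolding k_def by (intro absolutely_integrable_excess f) auto
  have k: "k integrable_on {a..b}" "\<And>x. 0 \<le> k x" "integral {a..b} k < e / 2"
    using kai n by (auto simp: k_def absolutely_integrable_on_def)
  have fint: "f integrable_on {a..b}" using f by (simp add: absolutely_integrable_on_def)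
  have *: "\<bar>integral {a..v} f - integral {a..u} f\<bar> \<le> real n * (v - u) + integral {u..v} k"
    if "u \<in> {a..b}" "v \<in> {a..b}" "u \<le> v" for u v
  proof -
    have sub: "{u..v} \<subseteq> {a..b}" using that by auto
    have ku: "k integrable_on {u..v}" using k(1) sub integrable_on_subinterval by blast
    have "integral {a..v} f - integral {a..u} f = integral {u..v} f"
      using integral_diff_eq[OF fint] that by auto
    also have "\<bar>\<dots>\<bar> \<le> integral {u..v} (\<lambda>x. real n + k x)"
    proof -
      have "norm (integral {u..v} f) \<le> integral {u..v} (\<lambda>x. real n + k x)"
        by (rule integral_norm_bound_integral)
          (use integrable_on_subinterval[OF fint sub] ku in \<open>auto simp: k_def intro!: integrable_add\<close>)
      then show ?thesis by simp
    qed
    also have "\<dots> = real n * (v - u) + integral {u..v} k"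
      using ku that(3) by (subst integral_add) auto
    finally show ?thesis .
  qed
  have "(\<Sum>(u, v)\<in>D. \<bar>integral {a..v} f - integral {a..u} f\<bar>) < e"
    if D: "nonoverlapping_in {a..b} D" "(\<Sum>(u, v)\<in>D. v - u) < e / (2 * (real n + 1))" for D
  proof -
    have "(\<Sum>(u, v)\<in>D. \<bar>integral {a..v} f - integral {a..u} f\<bar>)
          \<le> (\<Sum>(u, v)\<in>D. real n * (v - u) + integral {u..v} k)"
      by (intro sum_mono) (use nonoverlapping_inD[OF D(1)] in \<open>auto intro!: *\<close>)
    also have "\<dots> = real n * (\<Sum>(u, v)\<in>D. v - u) + (\<Sum>(u, v)\<in>D. integral {u..v} k)"
      by (simp add: case_prod_unfold sum.distrib sum_distrib_left)
    also have "\<dots> \<le> (real n + 1) * (\<Sum>(u, v)\<in>D. v - u) + integral {a..b} k"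
      using nonoverlapping_inD(1)[OF D(1)]
      by (intro add_mono mult_right_mono sum_integral_nonoverlapping_le k D sum_nonneg) auto
    also have "\<dots> < (real n + 1) * (e / (2 * (real n + 1))) + e / 2"
      using D(2) k(3) by (intro add_strict_mono mult_strict_left_mono) auto
    also have "\<dots> = e" by (simp add: field_simps)
    finally show ?thesis .
  qed
  then show "\<exists>d>0. \<forall>D. nonoverlapping_in {a..b} D \<longrightarrow> (\<Sum>(u, v)\<in>D. v - u) < d \<longrightarrow>
        (\<Sum>(u, v)\<in>D. \<bar>integral {a..v} f - integral {a..u} f\<bar>) < e"
    using \<open>e > 0\<close> by (intro exI[of _ "e / (2 * (real n + 1))"]) auto
qed

text \<open>Lebesgue's differentiation theorem in \<open>integrable_ccontinuous_explicit\<close> concerns the averages over \<open>[x, x + h]\<close> with \<open>h > 0\<close>, which gives the right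
  derivative of the indefinite integral.  The left derivative comes from the same theorem for the
  reflected function \<open>x \<mapsto> f (- x)\<close>.\<close>

lemma AE_integral_has_derivative:
  fixes f :: "real \<Rightarrow> real"
  assumes f: "f integrable_on {a..b}"
  shows "AE x\<in>{a..b} in lebesgue. ((\<lambda>x. integral {a..x} f) has_real_derivative f x) (at x)"
proof -
  define g where "g = (\<lambda>x. if x \<in> {a..b} then f x else 0)"
  have "g integrable_on UNIV" using f by (simp only: g_def integrable_restrict_UNIV)
  then have g: "g integrable_on cbox c d" for c d by (rule integrable_on_subcbox) auto
  then have g': "(\<lambda>x. g (- x)) integrable_on cbox c d" for c d
    using Henstock_Kurzweil_Integration.integrable_reflect_real[where f = g and a = "- d" and b = "- c"] by simp
  obtain N where N: "negligible N" "\<And>x e. \<lbrakk>x \<notin> N; 0 < e\<rbrakk> \<Longrightarrow>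
      \<exists>d>0. \<forall>h. 0 < h \<and> h < d \<longrightarrow> norm (integral (cbox x (x + h *\<^sub>R One)) g /\<^sub>R h ^ DIM(real) - g x) < e"
    using integrable_ccontinuous_explicit[OF g] by blast
  obtain N' where N': "negligible N'" "\<And>x e. \<lbrakk>x \<notin> N'; 0 < e\<rbrakk> \<Longrightarrow>
      \<exists>d>0. \<forall>h. 0 < h \<and> h < d \<longrightarrow> norm (integral (cbox x (x + h *\<^sub>R One)) (\<lambda>x. g (- x)) /\<^sub>R h ^ DIM(real) - g (- x)) < e"
    using integrable_ccontinuous_explicit[OF g'] by blast
  have "negligible (uminus ` N')"
    by (rule negligible_differentiable_image_negligible[OF _ N'(1)])
      (auto intro!: derivative_intros simp: differentiable_on_def)
  then have negl: "negligible (N \<union> uminus ` N' \<union> {a, b})" using N(1) by simp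
  have "((\<lambda>x. integral {a..x} f) has_real_derivative f x) (at x)"
    if "x \<notin> N \<union> uminus ` N' \<union> {a, b}" "x \<in> {a..b}" for x
    unfolding has_field_derivative_iff LIM_def
  proof (intro allI impI)
    fix e :: real assume "e > 0"
    have x: "a < x" "x < b" "x \<notin> N" "- x \<notin> N'" using that by (auto intro: image_eqI[of _ _ "- x"])
    obtain d1 where "d1 > 0" and d1: "\<And>h. \<lbrakk>0 < h; h < d1\<rbrakk> \<Longrightarrow> \<bar>integral {x..x + h} g / h - f x\<bar> < e"
      using N(2)[OF x(3) \<open>e > 0\<close>] x by (auto simp: g_def divide_inverse mult.commute)
    obtain d2 where "d2 > 0" and d2: "\<And>h. \<lbrakk>0 < h; h < d2\<rbrakk> \<Longrightarrow> \<bar>integral {- x..- x + h} (\<lambda>x. g (- x)) / h - f x\<bar> < e"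
      using N'(2)[OF x(4) \<open>e > 0\<close>] x by (auto simp: g_def divide_inverse mult.commute)
    define d where "d = Min {d1, d2, x - a, b - x}"
    have "d > 0" using \<open>d1 > 0\<close> \<open>d2 > 0\<close> x by (simp add: d_def)
    have gf: "integral {u..v} g = integral {u..v} f" if "a \<le> u" "v \<le> b" for u v
      using that by (intro integral_cong) (auto simp: g_def)
    have "\<bar>(integral {a..y} f - integral {a..x} f) / (y - x) - f x\<bar> < e" if "y \<noteq> x" "\<bar>y - x\<bar> < d" for y
    proof (cases "y > x")
      case True
      then have "integral {a..y} f - integral {a..x} f = integral {x..x + (y - x)} g"
        using that x integral_diff_eq[OF f, of x y] gf[of x y] by (auto simp: d_def)
      then show ?thesis using d1[of "y - x"] True that by (auto simp: d_def)
    next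
      case False
      then have "integral {a..x} f - integral {a..y} f = integral {y..x} g"
        using that x integral_diff_eq[OF f, of y x] gf[of y x] by (auto simp: d_def)
      also have "\<dots> = integral {- x..- x + (x - y)} (\<lambda>x. g (- x))"
        using Henstock_Kurzweil_Integration.integral_reflect_real[where f = g and a = y and b = x] by simp
      finally have "(integral {a..y} f - integral {a..x} f) / (y - x)
          = integral {- x..- x + (x - y)} (\<lambda>x. g (- x)) / (x - y)"
        using that by (simp add: field_simps)
      then show ?thesis using d2[of "x - y"] False that by (auto simp: d_def)
    qed
    then show "\<exists>s>0. \<forall>y. y \<noteq> x \<and> dist y x < s \<longrightarrow>
        dist ((integral {a..y} f - integral {a..x} f) / (y - x)) (f x) < e"
      using \<open>d > 0\<close> by (intro exI[of _ d]) (auto simp: dist_real_def)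
  qed
  moreover have "AE x in lebesgue. x \<notin> N \<union> uminus ` N' \<union> {a, b}"
    using negl by (intro AE_not_in) (simp add: negligible_iff_null_sets)
  ultimately show ?thesis by (smt (verit) eventually_mono)
qed

section \<open>Calculus of derivatives almost everywhere\<close>

definition has_ae_deriv :: "(real \<Rightarrow> real) \<Rightarrow> (real \<Rightarrow> real) \<Rightarrow> real \<Rightarrow> real \<Rightarrow> bool" where
  "has_ae_deriv f f' a b \<longleftrightarrow> abs_continuous_on {a..b} f \<and>
     (AE x\<in>{a..b} in lebesgue. (f has_real_derivative f' x) (at x))"

lemma has_ae_derivD:
  assumes "has_ae_deriv f f' a b"
  shows "abs_continuous_on {a..b} f" "AE x\<in>{a..b} in lebesgue. (f has_real_derivative f' x) (at x)"
    "continuous_on {a..b} f"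
  using assms abs_continuous_on_imp_continuous_on by (auto simp: has_ae_deriv_def)

lemma has_ae_deriv_subset:
  assumes "has_ae_deriv f f' a b" "a \<le> c" "d \<le> b"
  shows "has_ae_deriv f f' c d"
  unfolding has_ae_deriv_def
proof
  show "abs_continuous_on {c..d} f"
    using has_ae_derivD(1)[OF assms(1)] by (rule abs_continuous_on_subset) (use assms in auto)
  show "AE x\<in>{c..d} in lebesgue. (f has_real_derivative f' x) (at x)"
    using has_ae_derivD(2)[OF assms(1)] by eventually_elim (use assms in auto)
qed

lemma has_ae_deriv_diff:
  assumes "has_ae_deriv f f' a b" "has_ae_deriv g g' a b"
  shows "has_ae_deriv (\<lambda>x. f x - g x) (\<lambda>x. f' x - g' x) a b"
  unfolding has_ae_deriv_def
proof
  show "AE x\<in>{a..b} in lebesgue. ((\<lambda>x. f x - g x) has_real_derivative f' x - g' x) (at x)"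
    using assms[THEN has_ae_derivD(2)] by eventually_elim (auto intro: DERIV_diff)
qed (use assms in \<open>auto intro: abs_continuous_on_diff has_ae_derivD(1)\<close>)

lemma has_ae_deriv_mult:
  assumes "has_ae_deriv f f' a b" "has_ae_deriv g g' a b"
  shows "has_ae_deriv (\<lambda>x. f x * g x) (\<lambda>x. f' x * g x + f x * g' x) a b"
  unfolding has_ae_deriv_def
proof
  show "AE x\<in>{a..b} in lebesgue. ((\<lambda>x. f x * g x) has_real_derivative f' x * g x + f x * g' x) (at x)"
    using assms[THEN has_ae_derivD(2)]
    by eventually_elim (auto intro!: derivative_eq_intros simp: algebra_simps)
qed (use assms in \<open>auto intro: abs_continuous_on_mult has_ae_derivD(1)\<close>)

lemma has_ae_deriv_inverse:
  assumes "has_ae_deriv f f' a b" "\<And>x. x \<in> {a..b} \<Longrightarrow> f x > 0"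
  shows "has_ae_deriv (\<lambda>x. inverse (f x)) (\<lambda>x. - f' x / (f x)\<^sup>2) a b"
  unfolding has_ae_deriv_def
proof
  show "AE x\<in>{a..b} in lebesgue. ((\<lambda>x. inverse (f x)) has_real_derivative - f' x / (f x)\<^sup>2) (at x)"
    using has_ae_derivD(2)[OF assms(1)]
  proof eventually_elim
    case (elim x)
    then show ?case using assms(2)[of x]
      by (auto intro!: derivative_eq_intros simp: power2_eq_square divide_simps)
  qed
qed (use assms in \<open>auto intro: abs_continuous_on_inverse has_ae_derivD(1)\<close>)

lemma has_ae_deriv_exp:
  assumes "has_ae_deriv f f' a b"
  shows "has_ae_deriv (\<lambda>x. exp (f x)) (\<lambda>x. exp (f x) * f' x) a b"
  unfolding has_ae_deriv_def
proof
  show "AE x\<in>{a..b} in lebesgue. ((\<lambda>x. exp (f x)) has_real_derivative exp (f x) * f' x) (at x)"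
    using has_ae_derivD(2)[OF assms(1)] by eventually_elim (auto intro!: derivative_eq_intros)
qed (use assms in \<open>auto intro: abs_continuous_on_exp has_ae_derivD(1)\<close>)

lemma has_ae_deriv_const: "has_ae_deriv (\<lambda>x. c) (\<lambda>x. 0) a b"
  unfolding has_ae_deriv_def by (auto intro: abs_continuous_on_lipschitz[where C = 0])

lemma has_ae_deriv_C1:
  assumes deriv: "\<And>x. x \<in> {a..b} \<Longrightarrow> (f has_real_derivative f' x) (at x within {a..b})"
    and cont: "continuous_on {a..b} f'"
  shows "has_ae_deriv f f' a b"
  unfolding has_ae_deriv_def
proof
  have "bounded (f' ` {a..b})"
    by (intro compact_imp_bounded compact_continuous_image cont compact_Icc)
  then obtain B where B: "B > 0" "\<And>x. x \<in> {a..b} \<Longrightarrow> \<bar>f' x\<bar> \<le> B" by (auto simp: bounded_pos)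
  show "abs_continuous_on {a..b} f"
  proof (rule abs_continuous_on_lipschitz)
    fix u v assume "u \<in> {a..b}" "v \<in> {a..b}" "u \<le> v"
    then show "\<bar>f v - f u\<bar> \<le> B * \<bar>v - u\<bar>"
      using field_differentiable_bound[of "{a..b}" f f' B v u] deriv B(2) by auto
  qed
  have "AE x in lebesgue. x \<notin> {a, b}"
    by (rule AE_lebesgue_notin_finite) simp
  then show "AE x\<in>{a..b} in lebesgue. (f has_real_derivative f' x) (at x)"
  proof eventually_elim
    case (elim x)
    show ?case
    proof
      assume "x \<in> {a..b}"
      with elim have "x \<in> interior {a..b}" by auto
      then show "(f has_real_derivative f' x) (at x)"
        using deriv[of x] \<open>x \<in> {a..b}\<close> at_within_interior by metis
    qed
  qed
qed

lemma has_ae_deriv_integral: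
  assumes "f absolutely_integrable_on {a..b}"
  shows "has_ae_deriv (\<lambda>x. integral {a..x} f) f a b"
  unfolding has_ae_deriv_def
  using abs_continuous_on_integral[OF assms] AE_integral_has_derivative[of f a b] assms
  by (auto simp: absolutely_integrable_on_def)

lemma has_ae_deriv_nonneg_imp_le:
  assumes "has_ae_deriv f f' a b" "a \<le> b" "AE x\<in>{a..b} in lebesgue. 0 \<le> f' x"
  shows "f a \<le> f b"
proof (rule ac_AE_deriv_nonneg_imp_le[OF \<open>a \<le> b\<close> has_ae_derivD(1)[OF assms(1)]])
  show "AE x\<in>{a..b} in lebesgue. \<exists>D\<ge>0. (f has_real_derivative D) (at x)"
    using has_ae_derivD(2)[OF assms(1)] assms(3) by eventually_elim auto
qed

lemma has_ae_deriv_le_imp_diff_le: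
  assumes "has_ae_deriv f f' a b" "has_ae_deriv g g' a b" "a \<le> b" "AE x\<in>{a..b} in lebesgue. f' x \<le> g' x"
  shows "f b - f a \<le> g b - g a"
proof -
  have "AE x\<in>{a..b} in lebesgue. 0 \<le> g' x - f' x" using assms(4) by eventually_elim auto
  from has_ae_deriv_nonneg_imp_le[OF has_ae_deriv_diff[OF assms(2,1)] assms(3) this] show ?thesis by simp
qed

text \<open>This takes the role of the fundamental theorem of calculus: integral identities are obtained by comparing a
  function with an indefinite integral that has the same derivative almost everywhere.\<close>

lemma has_ae_deriv_eq_imp_diff_eq:
  assumes "has_ae_deriv f f' a b" "has_ae_deriv g g' a b" "a \<le> b" "AE x\<in>{a..b} in lebesgue. f' x = g' x"
  shows "f b - f a = g b - g a"
proof (rule antisym)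
  show "f b - f a \<le> g b - g a"
    by (rule has_ae_deriv_le_imp_diff_le[OF assms(1,2,3)]) (use assms(4) in \<open>eventually_elim; auto\<close>)
  show "g b - g a \<le> f b - f a"
    by (rule has_ae_deriv_le_imp_diff_le[OF assms(2,1,3)]) (use assms(4) in \<open>eventually_elim; auto\<close>)
qed

section \<open>Second-order linear equations with integrable coefficients\<close>

lemma absolutely_integrable_imp_integrable_subinterval:
  fixes f :: "real \<Rightarrow> real"
  assumes "f absolutely_integrable_on {a..b}" "{c..d} \<subseteq> {a..b}"
  shows "f integrable_on {c..d}"
  using assms integrable_on_subinterval unfolding absolutely_integrable_on_def by blast

text \<open>The pair \<open>(y, z)\<close> stands for \<open>(y, y')\<close>, where \<open>y'' = p y\<close> holds almost everywhere.\<close>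

definition solves :: "(real \<Rightarrow> real) \<Rightarrow> (real \<Rightarrow> real) \<Rightarrow> (real \<Rightarrow> real) \<Rightarrow> real \<Rightarrow> real \<Rightarrow> bool" where
  "solves p y z a b \<longleftrightarrow>
     (\<forall>x\<in>{a..b}. (y has_real_derivative z x) (at x within {a..b})) \<and>
     has_ae_deriv z (\<lambda>x. p x * y x) a b"

lemma solvesD:
  assumes "solves p y z a b"
  shows "has_ae_deriv y z a b" "has_ae_deriv z (\<lambda>x. p x * y x) a b"
    "continuous_on {a..b} y" "continuous_on {a..b} z"
    "\<And>x. x \<in> {a..b} \<Longrightarrow> (y has_real_derivative z x) (at x within {a..b})"
proof -
  show z: "has_ae_deriv z (\<lambda>x. p x * y x) a b" using assms by (simp add: solves_def)
  show y: "has_ae_deriv y z a b"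
    using assms has_ae_derivD(3)[OF z] by (intro has_ae_deriv_C1) (auto simp: solves_def)
  show "continuous_on {a..b} y" "continuous_on {a..b} z"
    using has_ae_derivD(3) y z by blast+
  show "\<And>x. x \<in> {a..b} \<Longrightarrow> (y has_real_derivative z x) (at x within {a..b})"
    using assms by (simp add: solves_def)
qed

lemma solves_subset:
  assumes "solves p y z a b" "a \<le> c" "d \<le> b"
  shows "solves p y z c d"
  unfolding solves_def
proof
  show "\<forall>x\<in>{c..d}. (y has_real_derivative z x) (at x within {c..d})"
    using solvesD(5)[OF assms(1)] assms(2,3)
    by (auto intro: DERIV_subset[of _ _ _ "{a..b}"])
  show "has_ae_deriv z (\<lambda>x. p x * y x) c d"
    using solvesD(2)[OF assms(1)] assms(2,3) by (rule has_ae_deriv_subset)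
qed

lemma solves_lincomb:
  assumes "solves p y z a b" "solves p y' z' a b"
  shows "solves p (\<lambda>x. c * y x - d * y' x) (\<lambda>x. c * z x - d * z' x) a b"
  unfolding solves_def
proof
  show "\<forall>x\<in>{a..b}. ((\<lambda>x. c * y x - d * y' x) has_real_derivative c * z x - d * z' x) (at x within {a..b})"
    using solvesD(5)[OF assms(1)] solvesD(5)[OF assms(2)]
    by (intro ballI DERIV_diff DERIV_cmult) blast+
  have "has_ae_deriv (\<lambda>x. c * z x - d * z' x)
      (\<lambda>x. (0 * z x + c * (p x * y x)) - (0 * z' x + d * (p x * y' x))) a b"
    by (intro has_ae_deriv_diff has_ae_deriv_mult has_ae_deriv_const solvesD(2)[OF assms(1)] solvesD(2)[OF assms(2)])
  then show "has_ae_deriv (\<lambda>x. c * z x - d * z' x) (\<lambda>x. p x * (c * y x - d * y' x)) a b"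
    by (simp add: algebra_simps)
qed

lemma has_ae_deriv_Wronskian:
  assumes "solves p y z a b" "solves p' y' z' a b"
  shows "has_ae_deriv (\<lambda>x. z x * y' x - y x * z' x) (\<lambda>x. (p x - p' x) * (y x * y' x)) a b"
proof -
  have "has_ae_deriv (\<lambda>x. z x * y' x - y x * z' x)
      (\<lambda>x. (p x * y x * y' x + z x * z' x) - (z x * z' x + y x * (p' x * y' x))) a b"
    by (intro has_ae_deriv_diff has_ae_deriv_mult solvesD[OF assms(1)] solvesD[OF assms(2)])
  then show ?thesis by (simp add: algebra_simps)
qed

lemma Wronskian_constant:
  assumes "solves p y z a b" "solves p y' z' a b" "u \<in> {a..b}" "v \<in> {a..b}"
  shows "z u * y' u - y u * z' u = z v * y' v - y v * z' v"
proof -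
  have *: "z v * y' v - y v * z' v = z a * y' a - y a * z' a" if "v \<in> {a..b}" for v
  proof -
    have "has_ae_deriv (\<lambda>x. z x * y' x - y x * z' x) (\<lambda>x. 0) a v"
      using has_ae_deriv_subset[OF has_ae_deriv_Wronskian[OF assms(1,2)], of a v] that by auto
    from has_ae_deriv_eq_imp_diff_eq[OF this has_ae_deriv_const[of 0]] that show ?thesis by auto
  qed
  show ?thesis using *[OF assms(3)] *[OF assms(4)] by simp
qed

lemma solves_integral:
  assumes p: "p absolutely_integrable_on {a..b}" and y: "solves p y z a b" and x: "x \<in> {a..b}"
  shows "z x - z a = integral {a..x} (\<lambda>s. p s * y s)" "y x - y a = integral {a..x} z"
proof -
  have "has_ae_deriv (\<lambda>x. integral {a..x} (\<lambda>s. p s * y s)) (\<lambda>s. p s * y s) a b"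
    by (intro has_ae_deriv_integral absolutely_integrable_continuous_mult p solvesD(3)[OF y])
  from has_ae_deriv_eq_imp_diff_eq[OF has_ae_deriv_subset[OF solvesD(2)[OF y], of a x]
      has_ae_deriv_subset[OF this, of a x]] x
  show "z x - z a = integral {a..x} (\<lambda>s. p s * y s)" by auto
  have "has_ae_deriv (\<lambda>x. integral {a..x} z) z a b"
    by (intro has_ae_deriv_integral absolutely_integrable_continuous_real solvesD(4)[OF y])
  from has_ae_deriv_eq_imp_diff_eq[OF has_ae_deriv_subset[OF solvesD(1)[OF y], of a x]
      has_ae_deriv_subset[OF this, of a x]] x
  show "y x - y a = integral {a..x} z" by auto
qed

text \<open>With the weight \<open>exp (2 \<integral> k)\<close> in the supremum norm, integration against \<open>k\<close> has norm at most one half.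
  This makes the solution operator below a contraction on the whole interval.\<close>

lemma integral_times_exp_integral:
  fixes k :: "real \<Rightarrow> real"
  assumes k: "k absolutely_integrable_on {a..b}" and x: "x \<in> {a..b}"
  shows "integral {a..x} (\<lambda>s. k s * exp (2 * integral {a..s} k)) = (exp (2 * integral {a..x} k) - 1) / 2"
proof -
  let ?E = "\<lambda>s. exp (2 * integral {a..s} k)"
  have K: "has_ae_deriv (\<lambda>x. integral {a..x} k) k a b"
    by (rule has_ae_deriv_integral[OF k])
  have E: "has_ae_deriv ?E (\<lambda>s. ?E s * (0 * integral {a..s} k + 2 * k s)) a b"
    by (intro has_ae_deriv_exp has_ae_deriv_mult has_ae_deriv_const K)
  have "has_ae_deriv (\<lambda>s. 1 / 2 * ?E s)
      (\<lambda>s. 0 * ?E s + 1 / 2 * (?E s * (0 * integral {a..s} k + 2 * k s))) a b"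
    by (intro has_ae_deriv_mult has_ae_deriv_const E)
  then have "has_ae_deriv (\<lambda>s. 1 / 2 * ?E s) (\<lambda>s. k s * ?E s) a b"
    by (simp add: mult.commute)
  then have E2: "has_ae_deriv (\<lambda>s. 1 / 2 * ?E s) (\<lambda>s. k s * ?E s) a x"
    by (rule has_ae_deriv_subset) (use x in auto)
  have I: "has_ae_deriv (\<lambda>x. integral {a..x} (\<lambda>s. k s * ?E s)) (\<lambda>s. k s * ?E s) a x"
    using x by (intro has_ae_deriv_subset[OF has_ae_deriv_integral[OF
        absolutely_integrable_continuous_mult[OF k has_ae_derivD(3)[OF E]]]]) auto
  from has_ae_deriv_eq_imp_diff_eq[OF E2 I] x show ?thesis by (simp add: diff_divide_distrib)
qed

text \<open>The function \<open>exp (- \<integral> k) (c + \<integral> k u)\<close> is nonincreasing, since its derivative is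
  \<open>exp (- \<integral> k) k (u - c - \<integral> k u) \<le> 0\<close>, and its value at \<open>a\<close> is \<open>c\<close>.\<close>

lemma Gronwall_integral:
  fixes k u :: "real \<Rightarrow> real"
  assumes k: "k absolutely_integrable_on {a..b}" "\<And>x. x \<in> {a..b} \<Longrightarrow> 0 \<le> k x"
    and u: "continuous_on {a..b} u"
    and le: "\<And>x. x \<in> {a..b} \<Longrightarrow> u x \<le> c + integral {a..x} (\<lambda>s. k s * u s)"
    and x: "x \<in> {a..b}"
  shows "u x \<le> c * exp (integral {a..x} k)"
proof -
  let ?R = "\<lambda>x. integral {a..x} (\<lambda>s. k s * u s) - (- c)"
  let ?E = "\<lambda>x. exp (0 - integral {a..x} k)"
  have R: "has_ae_deriv ?R (\<lambda>s. k s * u s - 0) a b"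
    by (intro has_ae_deriv_diff has_ae_deriv_const has_ae_deriv_integral
        absolutely_integrable_continuous_mult k u)
  have E: "has_ae_deriv ?E (\<lambda>s. ?E s * (0 - k s)) a b"
    by (intro has_ae_deriv_exp has_ae_deriv_diff has_ae_deriv_const has_ae_deriv_integral k)
  have "has_ae_deriv (\<lambda>x. ?E x * ?R x)
      (\<lambda>s. ?E s * (0 - k s) * ?R s + ?E s * (k s * u s - 0)) a b"
    by (rule has_ae_deriv_mult[OF E R])
  then have "has_ae_deriv (\<lambda>x. ?E x * ?R x)
      (\<lambda>s. ?E s * (0 - k s) * ?R s + ?E s * (k s * u s - 0)) a x"
    by (rule has_ae_deriv_subset) (use x in auto)
  moreover have "?E s * (0 - k s) * ?R s + ?E s * (k s * u s - 0) \<le> 0" if "s \<in> {a..x}" for s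
  proof -
    have "?E s * k s * (u s - ?R s) \<le> 0"
      using le[of s] k(2)[of s] that x by (intro mult_nonneg_nonpos mult_nonneg_nonneg) auto
    then show ?thesis by (simp add: algebra_simps)
  qed
  ultimately have "?E x * ?R x - ?E a * ?R a \<le> 0 - 0"
    using x by (intro has_ae_deriv_le_imp_diff_le[OF _ has_ae_deriv_const[of 0]]) auto
  then have "?E x * ?R x \<le> c" by simp
  then have "exp (integral {a..x} k) * (?E x * ?R x) \<le> exp (integral {a..x} k) * c"
    by (intro mult_left_mono) auto
  moreover have "exp (integral {a..x} k) * (?E x * ?R x) = ?R x"
    by (simp flip: mult.assoc exp_add)
  ultimately have "?R x \<le> exp (integral {a..x} k) * c" by linarith
  then show ?thesis using le[OF x] by (simp add: mult.commute)
qed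

text \<open>The unknown is \<open>u = z / E\<close> with \<open>E = exp (2 \<integral> \<bar>p\<bar>)\<close>.  The equation becomes a fixed point problem
  for bounded continuous functions, in which \<open>Y u\<close> and \<open>Z u\<close> are the functions \<open>y\<close> and \<open>z\<close> obtained by
  integrating once and twice.  As \<open>E\<close> is nondecreasing and the interval has length one, the inner integral does
  not enlarge the weighted norm, and the outer one halves it.\<close>

lemma solution_exists:
  fixes p :: "real \<Rightarrow> real" and \<alpha> \<beta> :: real
  assumes p: "p absolutely_integrable_on {0..1}"
  obtains y z where "solves p y z 0 1" "y 0 = \<alpha>" "z 0 = \<beta>"
proof -
  define k where "k = (\<lambda>x. \<bar>p x\<bar>)"
  have k: "k absolutely_integrable_on {0..1}" unfolding k_def using p by (rule set_integrable_abs)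
  define E where "E = (\<lambda>x. exp (2 * integral {0..x} k))"
  have k_int: "k integrable_on {0..x}" if "x \<in> {0..1}" for x
    by (rule absolutely_integrable_imp_integrable_subinterval[OF k]) (use that in auto)
  have contE: "continuous_on {0..1} E"
    unfolding E_def using k
    by (intro continuous_intros indefinite_integral_continuous_1) (simp add: absolutely_integrable_on_def)
  have E_mono: "E r \<le> E s" if "r \<in> {0..1}" "s \<in> {0..1}" "r \<le> s" for r s
  proof -
    have "integral {0..r} k \<le> integral {0..s} k"
      using that k_int by (intro integral_subset_le) (auto simp: k_def)
    then show ?thesis by (simp add: E_def)
  qed
  have E_ge1: "E x \<ge> 1" if "x \<in> {0..1}" for x
    using E_mono[of 0 x] that by (simp add: E_def)
  define Y where "Y = (\<lambda>u x. \<alpha> + integral {0..x} (\<lambda>r. E r * u r))"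
  define Z where "Z = (\<lambda>u x. \<beta> + integral {0..x} (\<lambda>s. p s * Y u s))"
  have Eu_int: "(\<lambda>r. E r * u r) integrable_on {0..x}" if "continuous_on {0..1} u" "x \<in> {0..1}" for u x
    using that by (intro integrable_continuous_real continuous_on_mult)
       (auto intro: continuous_on_subset contE)
  have contY: "continuous_on {0..1} (Y u)" if "continuous_on {0..1} u" for u
    unfolding Y_def using Eu_int[OF that, of 1]
    by (intro continuous_intros indefinite_integral_continuous_1) auto
  have pY: "(\<lambda>s. p s * Y u s) absolutely_integrable_on {0..1}" if "continuous_on {0..1} u" for u
    by (intro absolutely_integrable_continuous_mult p contY that)
  have pY_int: "(\<lambda>s. p s * Y u s) integrable_on {0..x}" if "continuous_on {0..1} u" "x \<in> {0..1}" for u x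
    by (rule absolutely_integrable_imp_integrable_subinterval[OF pY[OF that(1)]]) (use that(2) in auto)
  have contZ: "continuous_on {0..1} (Z u)" if "continuous_on {0..1} u" for u
    unfolding Z_def using pY_int[OF that, of 1]
    by (intro continuous_intros indefinite_integral_continuous_1) auto
  have "\<exists>g :: real \<Rightarrow>\<^sub>C real. \<forall>x. g x = Z u (clamp 0 1 x) / E (clamp 0 1 x)" for u :: "real \<Rightarrow>\<^sub>C real"
  proof -
    have "continuous_on (cbox 0 1) (\<lambda>x. Z u x / E x)"
      using contZ[of u] contE E_ge1 by (intro continuous_on_divide) force+
    then show ?thesis by (rule continuous_on_cbox_bcontfunE) blast
  qed
  \<comment> \<open>Functions on \<open>{0..1}\<close> are extended by constants, since the complete metric space consists of
    functions on the whole line.\<close>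
  then obtain T :: "(real \<Rightarrow>\<^sub>C real) \<Rightarrow> (real \<Rightarrow>\<^sub>C real)"
    where T: "\<And>u x. T u x = Z u (clamp 0 1 x) / E (clamp 0 1 x)" by metis
  have "dist (T u) (T v) \<le> 1 / 2 * dist u v" for u v
  proof (rule dist_bound)
    fix x :: real
    define c where "c = clamp 0 1 x"
    have c: "c \<in> {0..1}" using clamp_in_interval[of "0::real" 1 x] by (simp add: c_def)
    have Y_diff: "\<bar>Y u s - Y v s\<bar> \<le> E s * dist u v" if s: "s \<in> {0..1}" for s
    proof -
      have "Y u s - Y v s = integral {0..s} (\<lambda>r. E r * u r - E r * v r)"
        unfolding Y_def using s by (simp add: Henstock_Kurzweil_Integration.integral_diff[OF Eu_int Eu_int])
      moreover have "norm (integral {0..s} (\<lambda>r. E r * u r - E r * v r)) \<le> integral {0..s} (\<lambda>r. E s * dist u v)"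
      proof (rule integral_norm_bound_integral)
        fix r assume r: "r \<in> {0..s}"
        have "\<bar>E r * u r - E r * v r\<bar> = E r * dist (u r) (v r)"
          using E_ge1[of r] r s by (simp add: dist_real_def abs_mult flip: right_diff_distrib)
        also have "\<dots> \<le> E s * dist u v"
          using E_ge1[of s] r s by (intro mult_mono E_mono dist_bounded) auto
        finally show "norm (E r * u r - E r * v r) \<le> E s * dist u v" by simp
      qed (use s in \<open>auto intro!: integrable_diff Eu_int\<close>)
      moreover have "integral {0..s} (\<lambda>r. E s * dist u v) = s * (E s * dist u v)" using s by simp
      moreover have "s * (E s * dist u v) \<le> 1 * (E s * dist u v)"
        using s E_ge1[OF s] by (intro mult_right_mono) auto
      ultimately show ?thesis unfolding real_norm_def by linarith
    qed
    have "Z u c - Z v c = integral {0..c} (\<lambda>s. p s * Y u s - p s * Y v s)"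
      unfolding Z_def using c by (simp add: Henstock_Kurzweil_Integration.integral_diff[OF pY_int pY_int])
    moreover have "norm (integral {0..c} (\<lambda>s. p s * Y u s - p s * Y v s)) \<le> integral {0..c} (\<lambda>s. k s * E s * dist u v)"
    proof (rule integral_norm_bound_integral)
      fix s assume "s \<in> {0..c}"
      then have "s \<in> {0..1}" using c by auto
      have "\<bar>p s * Y u s - p s * Y v s\<bar> = k s * \<bar>Y u s - Y v s\<bar>"
        by (simp add: k_def abs_mult flip: right_diff_distrib)
      also have "\<dots> \<le> k s * (E s * dist u v)"
        using Y_diff[OF \<open>s \<in> {0..1}\<close>] by (intro mult_left_mono) (auto simp: k_def)
      finally show "norm (p s * Y u s - p s * Y v s) \<le> k s * E s * dist u v" by simp
    next
      have "(\<lambda>s. k s * E s) integrable_on {0..c}"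
        by (rule absolutely_integrable_imp_integrable_subinterval[OF
              absolutely_integrable_continuous_mult[OF k contE]]) (use c in auto)
      then show "(\<lambda>s. k s * E s * dist u v) integrable_on {0..c}" by (rule integrable_on_mult_left)
    qed (use c in \<open>auto intro!: integrable_diff pY_int\<close>)
    moreover have "integral {0..c} (\<lambda>s. k s * E s * dist u v) = (E c - 1) / 2 * dist u v"
      using integral_times_exp_integral[OF k c] by (simp add: E_def)
    ultimately have "\<bar>Z u c - Z v c\<bar> \<le> (E c - 1) / 2 * dist u v"
      unfolding real_norm_def by linarith
    also have "\<dots> \<le> E c / 2 * dist u v" by (intro mult_right_mono) auto
    finally have "\<bar>Z u c - Z v c\<bar> / E c \<le> 1 / 2 * dist u v"
      using E_ge1[OF c] by (simp add: field_simps)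
    then show "dist (T u x) (T v x) \<le> 1 / 2 * dist u v"
      using E_ge1[OF c] by (simp add: T dist_real_def flip: c_def diff_divide_distrib)
  qed
  then obtain u where u: "T u = u" using banach_fix_type[of "1 / 2" T] by auto
  have Zu: "Z u x = E x * u x" if "x \<in> {0..1}" for x
  proof -
    have "u x = Z u x / E x" using T[of u x] that by (simp add: u)
    then show ?thesis using E_ge1[OF that] by simp
  qed
  have Yu: "Y u x = \<alpha> + integral {0..x} (Z u)" if "x \<in> {0..1}" for x
    unfolding Y_def using that by (intro arg_cong2[where f = "(+)"] refl integral_cong) (simp add: Zu)
  have "solves p (Y u) (Z u) 0 1"
    unfolding solves_def
  proof
    show "\<forall>x\<in>{0..1}. (Y u has_real_derivative Z u x) (at x within {0..1})"
    proof
      fix x :: real assume x: "x \<in> {0..1}"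
      have "((\<lambda>x. \<alpha> + integral {0..x} (Z u)) has_real_derivative 0 + Z u x) (at x within {0..1})"
        using integral_has_real_derivative[OF contZ x] by (intro DERIV_add DERIV_const) auto
      then show "(Y u has_real_derivative Z u x) (at x within {0..1})"
        by (auto intro: has_field_derivative_transform_within[OF _ zero_less_one x] simp: Yu)
    qed
    have "has_ae_deriv (\<lambda>x. integral {0..x} (\<lambda>s. p s * Y u s) - (- \<beta>)) (\<lambda>s. p s * Y u s - 0) 0 1"
      by (intro has_ae_deriv_diff has_ae_deriv_const has_ae_deriv_integral pY) auto
    then show "has_ae_deriv (Z u) (\<lambda>x. p x * Y u x) 0 1" by (simp add: Z_def[abs_def] add.commute)
  qed
  moreover have "Y u 0 = \<alpha>" "Z u 0 = \<beta>" by (simp_all add: Y_def Z_def)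
  ultimately show thesis by (rule that)
qed

text \<open>The difference of the two solutions satisfies the equation for \<open>m\<close> with the additional term
  \<open>(l - m) w y\<close>, so Gronwall's inequality applies to \<open>\<bar>y' - y\<bar> + \<bar>z' - z\<bar>\<close>.  The kernel \<open>k\<close> dominates
  \<open>1 + \<bar>q - m w\<bar>\<close> for all \<open>m\<close> within distance one of \<open>l\<close>, so that \<open>C\<close> is independent of \<open>m\<close>.\<close>

lemma solution_Lipschitz_in_parameter:
  fixes q w :: "real \<Rightarrow> real"
  assumes q: "q absolutely_integrable_on {0..1}" and w: "w absolutely_integrable_on {0..1}"
    and y: "solves (\<lambda>x. q x - l * w x) y z 0 1"
  obtains C where "C > 0"
    "\<And>m y' z' x. \<lbrakk>\<bar>m - l\<bar> \<le> 1; solves (\<lambda>x. q x - m * w x) y' z' 0 1; y' 0 = y 0; z' 0 = z 0; x \<in> {0..1}\<rbrakk>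
       \<Longrightarrow> \<bar>y' x - y x\<bar> \<le> C * \<bar>m - l\<bar> \<and> \<bar>z' x - z x\<bar> \<le> C * \<bar>m - l\<bar>"
proof -
  obtain B where B: "B > 0" "\<And>x. x \<in> {0..1} \<Longrightarrow> \<bar>y x\<bar> \<le> B"
    using abs_continuous_on_bounded[OF has_ae_derivD(1)[OF solvesD(1)[OF y]]] by blast
  define k where "k = (\<lambda>x. 1 + (\<bar>q x\<bar> + (\<bar>l\<bar> + 1) * \<bar>w x\<bar>))"
  have k: "k absolutely_integrable_on {0..1}"
    unfolding k_def
    by (intro set_integral_add set_integrable_abs set_integrable_mult_right q w) auto
  have W: "(\<lambda>x. \<bar>w x\<bar>) integrable_on {0..1}"
    using set_integrable_abs[OF w] by (simp add: absolutely_integrable_on_def)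
  define J where "J = integral {0..1} (\<lambda>x. \<bar>w x\<bar>)"
  have "J \<ge> 0" unfolding J_def by (rule integral_nonneg[OF W]) auto
  define C where "C = J * B * exp (integral {0..1} k) + 1"
  have "C > 0" using \<open>J \<ge> 0\<close> B(1) by (simp add: C_def add_nonneg_pos)
  show thesis
  proof (rule that[OF \<open>C > 0\<close>])
    fix m y' z' x
    assume m: "\<bar>m - l\<bar> \<le> 1" and y': "solves (\<lambda>x. q x - m * w x) y' z' 0 1" "y' 0 = y 0" "z' 0 = z 0"
      and x: "x \<in> {0..1::real}"
    define u where "u = (\<lambda>x. \<bar>y' x - y x\<bar> + \<bar>z' x - z x\<bar>)"
    have cu: "continuous_on {0..1} u"
      unfolding u_def by (intro continuous_intros solvesD(3,4)[OF y] solvesD(3,4)[OF y'(1)])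
    have p: "(\<lambda>x. q x - c * w x) absolutely_integrable_on {0..1}" for c
      by (intro set_integral_diff set_integrable_mult_right q w)
    have ku_int: "(\<lambda>s. k s * u s) integrable_on {0..t}" if "t \<in> {0..1}" for t
      by (rule absolutely_integrable_imp_integrable_subinterval[OF
            absolutely_integrable_continuous_mult[OF k cu]]) (use that in auto)
    have le: "u t \<le> \<bar>m - l\<bar> * (J * B) + integral {0..t} (\<lambda>s. k s * u s)" if t: "t \<in> {0..1}" for t
    proof -
      have sub: "{0..t} \<subseteq> {0..1}" using t by auto
      have zint: "z integrable_on {0..t}" "z' integrable_on {0..t}"
        using solvesD(4)[OF y] solvesD(4)[OF y'(1)] sub
        by (auto intro!: integrable_continuous_real intro: continuous_on_subset)
      have pint: "(\<lambda>s. (q s - l * w s) * y s) integrable_on {0..t}" "(\<lambda>s. (q s - m * w s) * y' s) integrable_on {0..t}"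
        using absolutely_integrable_imp_integrable_subinterval[OF
            absolutely_integrable_continuous_mult[OF p solvesD(3)[OF y]] sub]
          absolutely_integrable_imp_integrable_subinterval[OF
            absolutely_integrable_continuous_mult[OF p solvesD(3)[OF y'(1)]] sub] by auto
      have wint: "(\<lambda>s. \<bar>m - l\<bar> * (\<bar>w s\<bar> * B)) integrable_on {0..t}"
        using integrable_on_subinterval[OF W sub] by (intro integrable_on_mult_right integrable_on_mult_left)
      have "y' t - y t = integral {0..t} z' - integral {0..t} z"
        using solves_integral(2)[OF p y t] solves_integral(2)[OF p y'(1) t] y'(2) by linarith
      also have "\<dots> = integral {0..t} (\<lambda>s. z' s - z s)"
        using zint by (simp add: Henstock_Kurzweil_Integration.integral_diff)
      finally have 1: "\<bar>y' t - y t\<bar> \<le> integral {0..t} (\<lambda>s. \<bar>z' s - z s\<bar>)"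
        using integral_norm_bound_integral[of "\<lambda>s. z' s - z s" "{0..t}" "\<lambda>s. \<bar>z' s - z s\<bar>"] zint
          solvesD(4)[OF y] solvesD(4)[OF y'(1)] sub
        by (force intro!: integrable_diff integrable_continuous_real continuous_intros intro: continuous_on_subset)
      have "z' t - z t = integral {0..t} (\<lambda>s. (q s - m * w s) * y' s) - integral {0..t} (\<lambda>s. (q s - l * w s) * y s)"
        using solves_integral(1)[OF p y t] solves_integral(1)[OF p y'(1) t] y'(3) by linarith
      also have "\<dots> = integral {0..t} (\<lambda>s. (q s - m * w s) * y' s - (q s - l * w s) * y s)"
        using pint by (simp add: Henstock_Kurzweil_Integration.integral_diff)
      finally have 2: "z' t - z t = integral {0..t} (\<lambda>s. (q s - m * w s) * y' s - (q s - l * w s) * y s)" .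
      have zabs: "(\<lambda>s. \<bar>z' s - z s\<bar>) integrable_on {0..t}"
        using solvesD(4)[OF y] solvesD(4)[OF y'(1)] sub
        by (intro integrable_continuous_real continuous_intros) (auto intro: continuous_on_subset)
      have kz: "(\<lambda>s. k s * u s - \<bar>z' s - z s\<bar>) integrable_on {0..t}"
        by (intro integrable_diff ku_int t zabs)
      have 3: "\<bar>z' t - z t\<bar> \<le> integral {0..t} (\<lambda>s. (k s * u s - \<bar>z' s - z s\<bar>) + \<bar>m - l\<bar> * (\<bar>w s\<bar> * B))"
      proof -
        have "norm (z' t - z t) \<le> integral {0..t} (\<lambda>s. (k s * u s - \<bar>z' s - z s\<bar>) + \<bar>m - l\<bar> * (\<bar>w s\<bar> * B))"
          unfolding 2
        proof (rule integral_norm_bound_integral)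
          fix s assume "s \<in> {0..t}"
          then have s: "s \<in> {0..1}" using sub by auto
          have "\<bar>(q s - m * w s) * y' s - (q s - l * w s) * y s\<bar>
              = \<bar>(q s - m * w s) * (y' s - y s) + (l - m) * (w s * y s)\<bar>"
            by (simp add: algebra_simps)
          also have "\<dots> \<le> \<bar>q s - m * w s\<bar> * \<bar>y' s - y s\<bar> + \<bar>m - l\<bar> * (\<bar>w s\<bar> * \<bar>y s\<bar>)"
            using abs_triangle_ineq[of "(q s - m * w s) * (y' s - y s)" "(l - m) * (w s * y s)"]
            by (simp add: abs_mult abs_minus_commute)
          also have "\<dots> \<le> (\<bar>q s\<bar> + (\<bar>l\<bar> + 1) * \<bar>w s\<bar>) * \<bar>y' s - y s\<bar> + \<bar>m - l\<bar> * (\<bar>w s\<bar> * B)"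
          proof (intro add_mono mult_right_mono mult_left_mono)
            have "\<bar>m\<bar> * \<bar>w s\<bar> \<le> (\<bar>l\<bar> + 1) * \<bar>w s\<bar>" using m by (intro mult_right_mono) auto
            then show "\<bar>q s - m * w s\<bar> \<le> \<bar>q s\<bar> + (\<bar>l\<bar> + 1) * \<bar>w s\<bar>"
              using abs_triangle_ineq4[of "q s" "m * w s"] by (simp add: abs_mult)
          qed (use B(2)[OF s] in auto)
          also have "\<dots> \<le> (k s * u s - \<bar>z' s - z s\<bar>) + \<bar>m - l\<bar> * (\<bar>w s\<bar> * B)"
          proof -
            have "0 \<le> (\<bar>q s\<bar> + (\<bar>l\<bar> + 1) * \<bar>w s\<bar>) * \<bar>z' s - z s\<bar>" by (intro mult_nonneg_nonneg add_nonneg_nonneg) auto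
            then show ?thesis by (simp add: k_def u_def algebra_simps)
          qed
          finally show "norm ((q s - m * w s) * y' s - (q s - l * w s) * y s)
             \<le> (k s * u s - \<bar>z' s - z s\<bar>) + \<bar>m - l\<bar> * (\<bar>w s\<bar> * B)" by simp
        qed (intro integrable_add integrable_diff pint kz wint)+
        then show ?thesis by simp
      qed
      have "integral {0..t} (\<lambda>s. (k s * u s - \<bar>z' s - z s\<bar>) + \<bar>m - l\<bar> * (\<bar>w s\<bar> * B))
        = integral {0..t} (\<lambda>s. k s * u s) - integral {0..t} (\<lambda>s. \<bar>z' s - z s\<bar>) + \<bar>m - l\<bar> * (integral {0..t} (\<lambda>s. \<bar>w s\<bar>) * B)"
        using kz wint ku_int[OF t] zabs
        by (simp add: Henstock_Kurzweil_Integration.integral_diff Henstock_Kurzweil_Integration.integral_add)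
      moreover have "\<bar>m - l\<bar> * (integral {0..t} (\<lambda>s. \<bar>w s\<bar>) * B) \<le> \<bar>m - l\<bar> * (J * B)"
        unfolding J_def using sub B(1) W integrable_on_subinterval[OF W sub]
        by (intro mult_left_mono mult_right_mono integral_subset_le) auto
      ultimately show ?thesis using 1 3 by (simp add: u_def)
    qed
    have "u x \<le> \<bar>m - l\<bar> * (J * B) * exp (integral {0..x} k)"
      by (rule Gronwall_integral[OF k _ cu le x]) (simp_all add: k_def)
    also have "\<dots> \<le> \<bar>m - l\<bar> * (J * B) * exp (integral {0..1} k)"
    proof (rule mult_left_mono)
      have "integral {0..x} k \<le> integral {0..1} k"
        using x by (intro integral_subset_le absolutely_integrable_imp_integrable_subinterval[OF k])
          (auto simp: k_def)
      then show "exp (integral {0..x} k) \<le> exp (integral {0..1} k)" by simp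
    qed (use \<open>J \<ge> 0\<close> B(1) in simp)
    also have "\<dots> \<le> C * \<bar>m - l\<bar>" by (simp add: C_def algebra_simps)
    finally show "\<bar>y' x - y x\<bar> \<le> C * \<bar>m - l\<bar> \<and> \<bar>z' x - z x\<bar> \<le> C * \<bar>m - l\<bar>"
      unfolding u_def by linarith
  qed
qed

section \<open>The first Dirichlet eigenvalue\<close>

lemma integral_pos_AE:
  fixes f :: "real \<Rightarrow> real"
  assumes f: "f absolutely_integrable_on {a..b}" and pos: "AE x\<in>{a..b} in lebesgue. 0 < f x" and "a < b"
  shows "0 < integral {a..b} f"
proof -
  obtain n :: nat where n: "integral {a..b} (\<lambda>x. max 0 (\<bar>1\<bar> - real n * f x)) < b - a"
    by (rule integral_excess_small[where f = "\<lambda>x. 1" and a = a and b = b and w = f and e = "b - a"])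
      (use assms in auto)
  have 1: "(\<lambda>x. max 0 (\<bar>1\<bar> - real n * f x)) integrable_on {a..b}"
    using absolutely_integrable_excess[where f = "\<lambda>x. 1" and a = a and b = b and w = f and c = "real n"] f by (auto simp: absolutely_integrable_on_def)
  have 2: "(\<lambda>x. real n * f x) integrable_on {a..b}"
    using f by (auto simp: absolutely_integrable_on_def intro: integrable_on_mult_right)
  have "b - a = integral {a..b} (\<lambda>x. 1 :: real)" using \<open>a < b\<close> by simp
  also have "\<dots> \<le> integral {a..b} (\<lambda>x. max 0 (\<bar>1\<bar> - real n * f x) + real n * f x)"
    by (intro integral_le integrable_add 1 2) auto
  also have "\<dots> = integral {a..b} (\<lambda>x. max 0 (\<bar>1\<bar> - real n * f x)) + real n * integral {a..b} f"
    using 1 2 by (simp add: Henstock_Kurzweil_Integration.integral_add)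
  finally have "0 < real n * integral {a..b} f" using n by linarith
  then show ?thesis by (simp add: zero_less_mult_iff)
qed

text \<open>The first zero is the least element of the compact set \<open>{x \<in> {a..b}. 0 \<le> g x}\<close>.\<close>

lemma first_zero:
  fixes g :: "real \<Rightarrow> real"
  assumes cont: "continuous_on {a..b} g" and "a \<le> b" "g a < 0" "0 \<le> g b"
  obtains c where "a < c" "c \<le> b" "g c = 0" "\<And>x. \<lbrakk>a \<le> x; x < c\<rbrakk> \<Longrightarrow> g x < 0"
proof -
  let ?K = "{x \<in> {a..b}. 0 \<le> g x}"
  have "closed ?K"
    using continuous_closed_preimage[OF cont closed_atLeastAtMost, of "{0..}"] closed_atLeast
    by (simp add: vimage_def Int_def continuous_closed_preimage[OF cont])
  then have "compact ?K"
    by (auto simp: compact_eq_bounded_closed intro: bounded_subset[OF bounded_closed_interval, of _ a b])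
  then obtain c where c: "c \<in> ?K" "\<And>x. x \<in> ?K \<Longrightarrow> c \<le> x"
    using compact_attains_inf[of ?K] assms by auto
  have "c \<noteq> a" using c(1) \<open>g a < 0\<close> by auto
  then have "a < c" using c(1) by auto
  have less: "g x < 0" if "a \<le> x" "x < c" for x using c that by force
  obtain d where d: "a \<le> d" "d \<le> c" "g d = 0"
    using IVT'[of g a 0 c] c(1) \<open>g a < 0\<close> continuous_on_subset[OF cont, of "{a..c}"] by auto
  then have "d = c" using less[of d] by force
  show thesis by (rule that[OF \<open>a < c\<close> _ _ less]) (use c d \<open>d = c\<close> in auto)
qed

lemma Lipschitz_at_imp_isCont:
  fixes f :: "real \<Rightarrow> real"
  assumes "\<And>m. \<bar>m - l\<bar> \<le> 1 \<Longrightarrow> \<bar>f m - f l\<bar> \<le> C * \<bar>m - l\<bar>"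
  shows "isCont f l"
proof -
  have "((\<lambda>m. f m - f l) \<longlongrightarrow> 0) (at l)"
  proof (rule Lim_null_comparison)
    show "eventually (\<lambda>m. norm (f m - f l) \<le> C * \<bar>m - l\<bar>) (at l)"
      using assms by (auto simp: eventually_at dist_real_def intro!: exI[of _ 1])
    have "((\<lambda>m. C * \<bar>m - l\<bar>) \<longlongrightarrow> C * \<bar>l - l\<bar>) (at l)" by (intro tendsto_intros)
    then show "((\<lambda>m. C * \<bar>m - l\<bar>) \<longlongrightarrow> 0) (at l)" by simp
  qed
  then show ?thesis by (simp add: isCont_def LIM_zero_iff)
qed

locale weighted_equation =
  fixes q w :: "real \<Rightarrow> real"
  assumes q: "q absolutely_integrable_on {0..1}" and w: "w absolutely_integrable_on {0..1}"
    and w_pos: "AE x\<in>{0..1} in lebesgue. 0 < w x"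
begin

abbreviation p :: "real \<Rightarrow> real \<Rightarrow> real" where
  "p l x \<equiv> q x - l * w x"

lemma p_int: "p l absolutely_integrable_on {0..1}"
  by (intro set_integral_diff set_integrable_mult_right q w)

text \<open>The pair \<open>(y, y')\<close> of the solution with \<open>y(0) = \<alpha>\<close> and \<open>y'(0) = \<beta>\<close>.\<close>

definition sol :: "real \<Rightarrow> real \<Rightarrow> real \<Rightarrow> (real \<Rightarrow> real) \<times> (real \<Rightarrow> real)" where
  "sol \<alpha> \<beta> l = (SOME s. solves (p l) (fst s) (snd s) 0 1 \<and> fst s 0 = \<alpha> \<and> snd s 0 = \<beta>)"

definition "phi l = fst (sol 0 1 l)"
definition "dphi l = snd (sol 0 1 l)"
definition "chi l = fst (sol 1 0 l)"
definition "dchi l = snd (sol 1 0 l)"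
text \<open>This combination solves the terminal value problem \<open>y(1) = 0\<close>, \<open>y'(1) = -1\<close>.  Building it from
  solutions with data at \<open>0\<close> lets it inherit continuity in \<open>l\<close> from them.\<close>

definition "psi l x = phi l 1 * chi l x - chi l 1 * phi l x"
definition "dpsi l x = phi l 1 * dchi l x - chi l 1 * dphi l x"

lemma sol:
  "solves (p l) (fst (sol \<alpha> \<beta> l)) (snd (sol \<alpha> \<beta> l)) 0 1 \<and> fst (sol \<alpha> \<beta> l) 0 = \<alpha> \<and> snd (sol \<alpha> \<beta> l) 0 = \<beta>"
proof -
  obtain y z where "solves (p l) y z 0 1" "y 0 = \<alpha>" "z 0 = \<beta>"
    by (rule solution_exists[OF p_int])
  then have "\<exists>s. solves (p l) (fst s) (snd s) 0 1 \<and> fst s 0 = \<alpha> \<and> snd s 0 = \<beta>"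
    by (intro exI[of _ "(y, z)"]) simp
  then show ?thesis unfolding sol_def by (rule someI_ex)
qed

lemma phi: "solves (p l) (phi l) (dphi l) 0 1" "phi l 0 = 0" "dphi l 0 = 1"
  using sol[of l 0 1] by (simp_all add: phi_def dphi_def)

lemma chi: "solves (p l) (chi l) (dchi l) 0 1" "chi l 0 = 1" "dchi l 0 = 0"
  using sol[of l 1 0] by (simp_all add: chi_def dchi_def)

lemma psi: "solves (p l) (psi l) (dpsi l) 0 1" "psi l 1 = 0" "psi l 0 = phi l 1"
  using solves_lincomb[OF chi(1) phi(1)] by (simp_all add: psi_def[abs_def] dpsi_def[abs_def] phi chi)

lemma Wronskian_phi_chi: "x \<in> {0..1} \<Longrightarrow> dphi l x * chi l x - phi l x * dchi l x = 1"
  using Wronskian_constant[OF phi(1)[of l] chi(1), of x 0] by (simp add: phi chi)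

lemma Wronskian_phi_psi: "x \<in> {0..1} \<Longrightarrow> dphi l x * psi l x - phi l x * dpsi l x = phi l 1"
  using Wronskian_constant[OF phi(1)[of l] psi(1), of x 0] by (simp add: phi psi)

text \<open>The coefficients are Wronskians of the given solution with \<open>chi\<close> and \<open>phi\<close>, hence constant.  The lemma provides
  uniqueness of solutions on any subinterval, given the data at one point \<open>c\<close>.\<close>

lemma solution_lincomb_phi_chi:
  assumes y: "solves (p l) y z a b" and sub: "{a..b} \<subseteq> {0..1}" and c: "c \<in> {a..b}" and x: "x \<in> {a..b}"
  shows "y x = (z c * chi l c - y c * dchi l c) * phi l x + (dphi l c * y c - phi l c * z c) * chi l x"
    and "z x = (z c * chi l c - y c * dchi l c) * dphi l x + (dphi l c * y c - phi l c * z c) * dchi l x"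
proof -
  have "0 \<le> a" "b \<le> 1" using sub c by auto
  note on = solves_subset[OF _ this]
  have 1: "z c * chi l c - y c * dchi l c = z x * chi l x - y x * dchi l x"
    by (rule Wronskian_constant[OF y on[OF chi(1)] c x])
  have 2: "dphi l c * y c - phi l c * z c = dphi l x * y x - phi l x * z x"
    by (rule Wronskian_constant[OF on[OF phi(1)] y c x])
  have W: "dphi l x * chi l x = 1 + phi l x * dchi l x"
    using Wronskian_phi_chi[of x l] sub x by auto
  have "(z x * chi l x - y x * dchi l x) * phi l x + (dphi l x * y x - phi l x * z x) * chi l x
      = y x * (dphi l x * chi l x) - y x * (phi l x * dchi l x)" by algebra
  then show "y x = (z c * chi l c - y c * dchi l c) * phi l x + (dphi l c * y c - phi l c * z c) * chi l x"
    unfolding 1 2 W by (simp add: algebra_simps)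
  have "(z x * chi l x - y x * dchi l x) * dphi l x + (dphi l x * y x - phi l x * z x) * dchi l x
      = z x * (dphi l x * chi l x) - z x * (phi l x * dchi l x)" by algebra
  then show "z x = (z c * chi l c - y c * dchi l c) * dphi l x + (dphi l c * y c - phi l c * z c) * dchi l x"
    unfolding 1 2 W by (simp add: algebra_simps)
qed

lemma phi_DERIV: "x \<in> {0<..<1} \<Longrightarrow> (phi l has_real_derivative dphi l x) (at x)"
  using solvesD(5)[OF phi(1), of x l] by (simp add: at_within_Icc_at)

lemma psi_DERIV: "x \<in> {0<..<1} \<Longrightarrow> (psi l has_real_derivative dpsi l x) (at x)"
  using solvesD(5)[OF psi(1), of x l] by (simp add: at_within_Icc_at)

lemma phi_Lipschitz:
  obtains C where "C > 0" "\<And>m x. \<lbrakk>\<bar>m - l\<bar> \<le> 1; x \<in> {0..1}\<rbrakk> \<Longrightarrow> \<bar>phi m x - phi l x\<bar> \<le> C * \<bar>m - l\<bar>"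
    "\<And>m x. \<lbrakk>\<bar>m - l\<bar> \<le> 1; x \<in> {0..1}\<rbrakk> \<Longrightarrow> \<bar>dphi m x - dphi l x\<bar> \<le> C * \<bar>m - l\<bar>"
proof -
  obtain C where "C > 0" and C: "\<And>m y' z' x. \<lbrakk>\<bar>m - l\<bar> \<le> 1; solves (p m) y' z' 0 1;
      y' 0 = phi l 0; z' 0 = dphi l 0; x \<in> {0..1}\<rbrakk>
      \<Longrightarrow> \<bar>y' x - phi l x\<bar> \<le> C * \<bar>m - l\<bar> \<and> \<bar>z' x - dphi l x\<bar> \<le> C * \<bar>m - l\<bar>"
    using solution_Lipschitz_in_parameter[OF q w phi(1)] by blast
  show thesis
    by (rule that[OF \<open>C > 0\<close>]) (use C[OF _ phi(1)] in \<open>auto simp: phi\<close>)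
qed

lemma chi_Lipschitz:
  obtains C where "\<And>m x. \<lbrakk>\<bar>m - l\<bar> \<le> 1; x \<in> {0..1}\<rbrakk> \<Longrightarrow> \<bar>chi m x - chi l x\<bar> \<le> C * \<bar>m - l\<bar>"
proof -
  obtain C where "C > 0" and C: "\<And>m y' z' x. \<lbrakk>\<bar>m - l\<bar> \<le> 1; solves (p m) y' z' 0 1;
      y' 0 = chi l 0; z' 0 = dchi l 0; x \<in> {0..1}\<rbrakk>
      \<Longrightarrow> \<bar>y' x - chi l x\<bar> \<le> C * \<bar>m - l\<bar> \<and> \<bar>z' x - dchi l x\<bar> \<le> C * \<bar>m - l\<bar>"
    using solution_Lipschitz_in_parameter[OF q w chi(1)] by blast
  show thesis
    by (rule that) (use C[OF _ chi(1)] in \<open>auto simp: chi\<close>)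
qed

lemma isCont_phi: "x \<in> {0..1} \<Longrightarrow> isCont (\<lambda>l. phi l x) l"
  by (rule phi_Lipschitz[of l]) (rule Lipschitz_at_imp_isCont, blast)

lemma isCont_psi: "x \<in> {0..1} \<Longrightarrow> isCont (\<lambda>l. psi l x) l"
proof -
  have "isCont (\<lambda>l. chi l x) l" if "x \<in> {0..1}" for x
    by (rule chi_Lipschitz[of l]) (rule Lipschitz_at_imp_isCont, use that in blast)
  then show "x \<in> {0..1} \<Longrightarrow> isCont (\<lambda>l. psi l x) l"
    unfolding psi_def by (intro continuous_intros isCont_phi) auto
qed

text \<open>The derivative at a zero of \<open>phi\<close> is nonzero because the Wronskian with \<open>chi\<close> is one, and a positive derivative
  would force negative values to the left.\<close>

lemma dphi_neg_at_zero:
  assumes c: "0 < c" "c \<le> 1" "phi l c = 0" and pos: "\<And>x. \<lbrakk>0 < x; x < c\<rbrakk> \<Longrightarrow> 0 < phi l x"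
  shows "dphi l c < 0"
proof (rule ccontr)
  assume "\<not> dphi l c < 0"
  moreover have "dphi l c \<noteq> 0" using Wronskian_phi_chi[of c l] c by auto
  ultimately have "dphi l c > 0" by simp
  then obtain d where d: "d > 0" "\<And>h. \<lbrakk>0 < h; c - h \<in> {0..1}; h < d\<rbrakk> \<Longrightarrow> phi l (c - h) < phi l c"
    using has_real_derivative_pos_inc_left[OF solvesD(5)[OF phi(1)], of c l] c by auto
  define h where "h = min (c / 2) (d / 2)"
  have "0 < h" "h < c" "h < d" using c d by (auto simp: h_def min_def)
  then show False using d(2)[of h] pos[of "c - h"] c by auto
qed

lemma phi_first_zero:
  assumes "x \<in> {0<..1}" "phi l x \<le> 0"
  obtains c where "0 < c" "c \<le> x" "phi l c = 0" "\<And>u. \<lbrakk>0 < u; u < c\<rbrakk> \<Longrightarrow> 0 < phi l u"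
proof -
  have "(phi l has_real_derivative 1) (at 0 within {0..1})"
    using solvesD(5)[OF phi(1)[of l], of 0] phi(3) by simp
  from has_real_derivative_pos_inc_right[OF this]
  obtain d where d: "d > 0" "\<And>h. \<lbrakk>0 < h; h \<le> 1; h < d\<rbrakk> \<Longrightarrow> 0 < phi l h"
    by (auto simp: phi)
  define e where "e = min (x / 2) (d / 2)"
  have e: "0 < e" "e < x" "e < d" using assms d by (auto simp: e_def min_def)
  have "continuous_on {e..x} (\<lambda>u. - phi l u)"
    using solvesD(3)[OF phi(1)[of l]] e assms by (intro continuous_intros) (auto intro: continuous_on_subset)
  then obtain c where c: "e < c" "c \<le> x" "- phi l c = 0" "\<And>u. \<lbrakk>e \<le> u; u < c\<rbrakk> \<Longrightarrow> - phi l u < 0"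
    by (rule first_zero) (use e assms d(2)[of e] in auto)
  show thesis
  proof (rule that)
    show "0 < phi l u" if "0 < u" "u < c" for u
      using c(4)[of u] d(2)[of u] that c e assms by (cases "e \<le> u") auto
  qed (use c e in auto)
qed

definition positive_parameters :: "real set" where
  "positive_parameters = {l. \<forall>x\<in>{0<..1}. 0 < phi l x}"

text \<open>Sturm comparison.  For \<open>m < l\<close> the Wronskian \<open>\<phi>\<^sub>m' \<phi>\<^sub>l - \<phi>\<^sub>m \<phi>\<^sub>l'\<close> vanishes at \<open>0\<close> and has the derivative
  \<open>(l - m) w \<phi>\<^sub>m \<phi>\<^sub>l\<close>, which is nonnegative up to the first zero \<open>c\<close> of \<open>\<phi>\<^sub>m\<close>.  At \<open>c\<close> it equals
  \<open>\<phi>\<^sub>m'(c) \<phi>\<^sub>l(c)\<close>, which is negative if \<open>\<phi>\<^sub>l\<close> is positive.\<close>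

lemma positive_parameters_downward:
  assumes "l \<in> positive_parameters" "m < l"
  shows "m \<in> positive_parameters"
proof (rule ccontr)
  assume "m \<notin> positive_parameters"
  then obtain x where "x \<in> {0<..1}" "phi m x \<le> 0" by (auto simp: positive_parameters_def not_less)
  then obtain c where c: "0 < c" "c \<le> x" "phi m c = 0" "\<And>u. \<lbrakk>0 < u; u < c\<rbrakk> \<Longrightarrow> 0 < phi m u"
    using phi_first_zero by blast
  then have "c \<le> 1" using \<open>x \<in> {0<..1}\<close> by auto
  have neg: "dphi m c < 0" using dphi_neg_at_zero c \<open>c \<le> 1\<close> by blast
  have "has_ae_deriv (\<lambda>x. dphi m x * phi l x - phi m x * dphi l x) (\<lambda>x. (p m x - p l x) * (phi m x * phi l x)) 0 c"
    by (rule has_ae_deriv_subset[OF has_ae_deriv_Wronskian[OF phi(1) phi(1)]]) (use \<open>c \<le> 1\<close> in auto)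
  then have "dphi m 0 * phi l 0 - phi m 0 * dphi l 0 \<le> dphi m c * phi l c - phi m c * dphi l c"
  proof (rule has_ae_deriv_nonneg_imp_le)
    show "AE x\<in>{0..c} in lebesgue. 0 \<le> (p m x - p l x) * (phi m x * phi l x)"
      using w_pos
    proof eventually_elim
      case (elim x)
      show ?case
      proof
        assume x: "x \<in> {0..c}"
        have "p m x - p l x = (l - m) * w x" by (simp add: algebra_simps)
        moreover have "0 < w x" using elim x \<open>c \<le> 1\<close> by auto
        moreover have "0 \<le> phi m x" using c(3) c(4)[of x] x phi(2)[of m] by (cases "x = 0 \<or> x = c") (auto intro: less_imp_le)
        moreover have "0 \<le> phi l x" using assms(1) x \<open>c \<le> 1\<close> phi(2)[of l]
          by (cases "x = 0") (auto simp: positive_parameters_def intro: less_imp_le)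
        ultimately show "0 \<le> (p m x - p l x) * (phi m x * phi l x)" using assms(2) by simp
      qed
    qed
  qed (use c in auto)
  then have "0 \<le> dphi m c * phi l c" by (simp add: phi c)
  moreover have "0 < phi l c" using assms(1) c \<open>c \<le> 1\<close> by (auto simp: positive_parameters_def)
  ultimately show False using neg by (auto simp: zero_le_mult_iff)
qed

lemma phi_strict_mono:
  assumes "0 \<le> a" "a < b" "b \<le> 1" "\<And>x. \<lbrakk>a < x; x < b\<rbrakk> \<Longrightarrow> 0 < dphi l x"
  shows "phi l a < phi l b"
proof (rule DERIV_pos_imp_increasing_open[OF \<open>a < b\<close>])
  show "\<exists>y. (phi l has_real_derivative y) (at x) \<and> 0 < y" if "a < x" "x < b" for x
    using phi_DERIV[of x l] assms that by auto
  show "continuous_on {a..b} (phi l)"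
    using solvesD(3)[OF phi(1)[of l]] by (rule continuous_on_subset) (use assms in auto)
qed

text \<open>For \<open>l = -n\<close> the coefficient satisfies \<open>q + n w \<ge> -k\<close> with \<open>\<integral> k < 1/4\<close>.  The quotient \<open>s = \<phi>/\<phi>'\<close>
  satisfies \<open>s(0) = 0\<close> and \<open>s' = 1 - (q + n w) s\<^sup>2 \<le> 1 + k s\<^sup>2\<close>.  As long as \<open>s \<le> 2\<close> this gives
  \<open>s(d) \<le> d + 4 \<integral> k < 2\<close>, so \<open>s\<close> never reaches \<open>2\<close>.  But \<open>s\<close> would grow without bound if \<open>\<phi>'\<close> had a first zero.\<close>

lemma positive_parameters_nonempty: "\<exists>l. l \<in> positive_parameters"
proof -
  obtain n :: nat where n: "integral {0..1} (\<lambda>x. max 0 (\<bar>q x\<bar> - real n * w x)) < 1 / 4"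
    using integral_excess_small[OF q w w_pos, of "1 / 4"] by auto
  define k where "k = (\<lambda>x. max 0 (\<bar>q x\<bar> - real n * w x))"
  have k: "k absolutely_integrable_on {0..1}" unfolding k_def by (rule absolutely_integrable_excess[OF q w])
  define l where "l = - real n"
  have p_ge: "- k x \<le> p l x" for x by (auto simp: k_def l_def)
  have pos: "0 < dphi l x" if x: "x \<in> {0..1}" for x
  proof (rule ccontr)
    assume "\<not> 0 < dphi l x"
    have "continuous_on {0..x} (\<lambda>u. - dphi l u)"
      using solvesD(4)[OF phi(1)[of l]] x by (intro continuous_intros) (auto intro: continuous_on_subset)
    then obtain c where c: "0 < c" "c \<le> x" "- dphi l c = 0" "\<And>u. \<lbrakk>0 \<le> u; u < c\<rbrakk> \<Longrightarrow> - dphi l u < 0"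
      by (rule first_zero) (use x \<open>\<not> 0 < dphi l x\<close> phi(3)[of l] in auto)
    have "0 < phi l c"
      using phi_strict_mono[of 0 c l] c x by (auto simp: phi)
    have "continuous_on {0..c} (\<lambda>u. phi l u - 2 * dphi l u)"
      using solvesD(3,4)[OF phi(1)[of l]] x c by (intro continuous_intros) (auto intro: continuous_on_subset)
    then obtain d where d: "0 < d" "d \<le> c" "phi l d - 2 * dphi l d = 0"
        "\<And>u. \<lbrakk>0 \<le> u; u < d\<rbrakk> \<Longrightarrow> phi l u - 2 * dphi l u < 0"
      by (rule first_zero) (use c \<open>0 < phi l c\<close> in \<open>auto simp: phi\<close>)
    have "d \<noteq> c" using d(3) c(3) \<open>0 < phi l c\<close> by auto
    then have dphi_pos: "0 < dphi l u" if "u \<in> {0..d}" for u using c(4)[of u] that d(2) by auto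
    have "d \<le> 1" using d c x by auto
    define s where "s = (\<lambda>u. phi l u * inverse (dphi l u))"
    have s_bounds: "0 \<le> s u" "s u \<le> 2" if u: "u \<in> {0..d}" for u
    proof -
      have "0 \<le> phi l u"
        using phi_strict_mono[of 0 u l] dphi_pos u \<open>d \<le> 1\<close> phi(2)[of l] by (cases "u = 0") (auto intro: less_imp_le)
      moreover have "phi l u \<le> 2 * dphi l u" using d(3) d(4)[of u] u by (cases "u = d") auto
      ultimately show "0 \<le> s u" "s u \<le> 2" using dphi_pos[OF u] by (auto simp: s_def field_simps)
    qed
    note on = has_ae_deriv_subset[OF _ order.refl \<open>d \<le> 1\<close>]
    have "has_ae_deriv s (\<lambda>u. dphi l u * inverse (dphi l u) + phi l u * (- (p l u * phi l u) / (dphi l u)\<^sup>2)) 0 d"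
      unfolding s_def
      by (intro has_ae_deriv_mult has_ae_deriv_inverse on[OF solvesD(1)[OF phi(1)]] on[OF solvesD(2)[OF phi(1)]] dphi_pos)
    moreover have "has_ae_deriv (\<lambda>u. 4 * integral {0..u} k - - u) (\<lambda>u. (0 * integral {0..u} k + 4 * k u) - (- 1)) 0 d"
      by (intro has_ae_deriv_diff has_ae_deriv_mult has_ae_deriv_const on has_ae_deriv_integral k has_ae_deriv_C1)
         (auto intro!: derivative_eq_intros)
    ultimately have "s d - s 0 \<le> (4 * integral {0..d} k - - d) - (4 * integral {0..0} k - - 0)"
    proof (rule has_ae_deriv_le_imp_diff_le)
      have "dphi l u * inverse (dphi l u) + phi l u * (- (p l u * phi l u) / (dphi l u)\<^sup>2)
          \<le> (0 * integral {0..u} k + 4 * k u) - (- 1)" if u: "u \<in> {0..d}" for u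
      proof -
        have "- p l u * (s u)\<^sup>2 \<le> k u * (s u)\<^sup>2" using p_ge[of u] by (intro mult_right_mono) auto
        also have "\<dots> \<le> k u * 2\<^sup>2" using s_bounds[OF u] by (intro mult_left_mono power_mono) (auto simp: k_def)
        finally have "- p l u * (s u)\<^sup>2 \<le> 4 * k u" by simp
        moreover have "phi l u * (- (p l u * phi l u) / (dphi l u)\<^sup>2) = - p l u * (s u)\<^sup>2"
          by (simp add: s_def power2_eq_square field_simps)
        moreover have "dphi l u * inverse (dphi l u) = 1" using dphi_pos[OF u] by simp
        ultimately show ?thesis by simp
      qed
      then show "AE u\<in>{0..d} in lebesgue. dphi l u * inverse (dphi l u) + phi l u * (- (p l u * phi l u) / (dphi l u)\<^sup>2)
          \<le> (0 * integral {0..u} k + 4 * k u) - (- 1)" by auto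
    qed (use d in auto)
    moreover have "s d = 2" using d(3) dphi_pos[of d] d(1) by (simp add: s_def)
    moreover have "s 0 = 0" by (simp add: s_def phi)
    moreover have "integral {0..d} k \<le> integral {0..1} k"
      using \<open>d \<le> 1\<close> by (intro integral_subset_le absolutely_integrable_imp_integrable_subinterval[OF k]) (auto simp: k_def)
    ultimately show False using n \<open>d \<le> 1\<close> by (simp add: k_def)
  qed
  have "l \<in> positive_parameters"
    using phi_strict_mono[of 0 _ l] pos by (auto simp: positive_parameters_def phi)
  then show ?thesis by blast
qed

text \<open>Picone's identity: if \<open>\<phi>\<^sub>l > 0\<close> on \<open>[1/2, 1]\<close> then the derivative of \<open>v\<^sup>2 \<phi>\<^sub>l'/\<phi>\<^sub>l\<close> equals
  \<open>v'\<^sup>2 + (q - l w) v\<^sup>2 - (v' - v \<phi>\<^sub>l'/\<phi>\<^sub>l)\<^sup>2\<close>.  For a test function \<open>v\<close> vanishing at both ends this yields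
  \<open>l \<integral> w v\<^sup>2 \<le> \<integral> v'\<^sup>2 + q v\<^sup>2\<close>.  Working on \<open>[1/2, 1]\<close> keeps away from the zero of \<open>\<phi>\<^sub>l\<close> at \<open>0\<close>.\<close>

lemma positive_parameters_bdd_above: "bdd_above positive_parameters"
proof -
  define v where "v = (\<lambda>x :: real. (x - 1 / 2) * (1 - x))"
  define v' where "v' = (\<lambda>x :: real. 3 / 2 - 2 * x)"
  have cv: "continuous_on A v" "continuous_on A v'" for A
    unfolding v_def v'_def by (intro continuous_intros)+
  have v: "has_ae_deriv v v' (1 / 2) 1"
    by (intro has_ae_deriv_C1 cv) (auto simp: v_def v'_def intro!: derivative_eq_intros)
  have on: "f absolutely_integrable_on {1 / 2..1}" if "f absolutely_integrable_on {0..1}" for f :: "real \<Rightarrow> real"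
    using that by (rule set_integrable_subset) auto
  define G where "G = integral {1 / 2..1} (\<lambda>x. v' x * v' x) + integral {1 / 2..1} (\<lambda>x. q x * (v x * v x))"
  define H where "H = integral {1 / 2..1} (\<lambda>x. w x * (v x * v x))"
  have q_int: "(\<lambda>x. q x * (v x * v x)) absolutely_integrable_on {1 / 2..1}"
    and w_int: "(\<lambda>x. w x * (v x * v x)) absolutely_integrable_on {1 / 2..1}"
    by (intro absolutely_integrable_continuous_mult on q w continuous_intros cv)+
  have "H > 0"
    unfolding H_def
  proof (rule integral_pos_AE[OF w_int])
    have "AE x in lebesgue. x \<notin> {1 / 2, 1 :: real}"
      by (rule AE_lebesgue_notin_finite) simp
    with w_pos show "AE x\<in>{1 / 2..1} in lebesgue. 0 < w x * (v x * v x)"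
      by eventually_elim (auto simp: v_def zero_less_mult_iff)
  qed simp
  have "l \<le> G / H" if l: "l \<in> positive_parameters" for l
  proof -
    have pos: "0 < phi l x" if "x \<in> {1 / 2..1}" for x using l that by (auto simp: positive_parameters_def)
    note sub = has_ae_deriv_subset[where a = 0 and b = 1 and c = "1 / 2" and d = 1, simplified]
    have "has_ae_deriv (\<lambda>x. v x * v x * (dphi l x * inverse (phi l x)))
       (\<lambda>x. (v' x * v x + v x * v' x) * (dphi l x * inverse (phi l x))
          + v x * v x * (p l x * phi l x * inverse (phi l x) + dphi l x * (- dphi l x / (phi l x)\<^sup>2))) (1 / 2) 1"
      by (intro has_ae_deriv_mult has_ae_deriv_inverse v sub[OF solvesD(1)[OF phi(1)]] sub[OF solvesD(2)[OF phi(1)]] pos)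
    moreover have "has_ae_deriv (\<lambda>x. integral {1 / 2..x} (\<lambda>x. v' x * v' x) - (l * integral {1 / 2..x} (\<lambda>x. w x * (v x * v x))
          - integral {1 / 2..x} (\<lambda>x. q x * (v x * v x))))
        (\<lambda>x. v' x * v' x - ((0 * integral {1 / 2..x} (\<lambda>x. w x * (v x * v x)) + l * (w x * (v x * v x))) - q x * (v x * v x))) (1 / 2) 1"
      by (intro has_ae_deriv_diff has_ae_deriv_mult has_ae_deriv_const has_ae_deriv_integral q_int w_int
          absolutely_integrable_continuous_real continuous_intros cv)
    ultimately have "v 1 * v 1 * (dphi l 1 * inverse (phi l 1)) - v (1 / 2) * v (1 / 2) * (dphi l (1 / 2) * inverse (phi l (1 / 2)))
       \<le> (G - l * H) - 0"
    proof (rule has_ae_deriv_le_imp_diff_le[THEN order_trans])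
      have "(v' x * v x + v x * v' x) * (dphi l x * inverse (phi l x))
          + v x * v x * (p l x * phi l x * inverse (phi l x) + dphi l x * (- dphi l x / (phi l x)\<^sup>2))
         \<le> v' x * v' x - ((0 * integral {1 / 2..x} (\<lambda>x. w x * (v x * v x)) + l * (w x * (v x * v x))) - q x * (v x * v x))"
        if x: "x \<in> {1 / 2..1}" for x
      proof -
        define r where "r = dphi l x / phi l x"
        have eqs: "dphi l x * inverse (phi l x) = r" "p l x * phi l x * inverse (phi l x) = p l x"
          "dphi l x * (- dphi l x / (phi l x)\<^sup>2) = - r\<^sup>2"
          using pos[OF x] by (simp_all add: r_def field_simps power2_eq_square)
        have "0 \<le> (v' x - v x * r)\<^sup>2" by simp
        then have "2 * (v x * v' x * r) - v x * v x * r\<^sup>2 \<le> v' x * v' x"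
          by (simp add: power2_eq_square algebra_simps)
        then show ?thesis
          unfolding eqs by (simp add: algebra_simps)
      qed
      then show "AE x\<in>{1 / 2..1} in lebesgue. (v' x * v x + v x * v' x) * (dphi l x * inverse (phi l x))
          + v x * v x * (p l x * phi l x * inverse (phi l x) + dphi l x * (- dphi l x / (phi l x)\<^sup>2))
         \<le> v' x * v' x - ((0 * integral {1 / 2..x} (\<lambda>x. w x * (v x * v x)) + l * (w x * (v x * v x))) - q x * (v x * v x))"
        by auto
    qed (simp_all add: G_def H_def)
    moreover have "v 1 = 0" "v (1 / 2) = 0" by (simp_all add: v_def)
    ultimately have "l * H \<le> G" by simp
    then show ?thesis using \<open>H > 0\<close> by (simp add: field_simps)
  qed
  then show ?thesis by (rule bdd_aboveI)
qed

text \<open>The function \<open>\<phi>\<^sub>l(x)/x\<close> extends continuously to \<open>0\<close> by \<open>\<phi>\<^sub>l'(0) = 1\<close>, and its minimum on \<open>[0,1]\<close> is positive.\<close>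

lemma phi_ge_linear:
  assumes l: "l \<in> positive_parameters"
  obtains \<kappa> where "\<kappa> > 0" "\<And>x. x \<in> {0..1} \<Longrightarrow> \<kappa> * x \<le> phi l x"
proof -
  define h where "h = (\<lambda>x. if x = 0 then 1 else phi l x / x)"
  have "continuous_on {0..1} h"
    unfolding continuous_on_def
  proof
    fix x :: real assume x: "x \<in> {0..1}"
    show "(h \<longlongrightarrow> h x) (at x within {0..1})"
    proof (cases "x = 0")
      case True
      have "((\<lambda>y. (phi l y - phi l 0) / (y - 0)) \<longlongrightarrow> 1) (at 0 within {0..1})"
        using solvesD(5)[OF phi(1)[of l], of 0] by (simp add: has_field_derivative_iff phi)
      then have "(h \<longlongrightarrow> 1) (at 0 within {0..1})"
        by (rule Lim_transform_within[OF _ zero_less_one]) (auto simp: h_def phi)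
      then show ?thesis unfolding True by (simp add: h_def)
    next
      case False
      have "((\<lambda>y. phi l y / y) \<longlongrightarrow> phi l x / x) (at x within {0..1})"
        using solvesD(3)[OF phi(1)[of l]] x False by (intro tendsto_intros) (auto simp: continuous_on_def)
      then have "(h \<longlongrightarrow> phi l x / x) (at x within {0..1})"
        by (rule Lim_transform_within[where d = x]) (use x False in \<open>auto simp: h_def dist_real_def\<close>)
      then show ?thesis using False by (simp add: h_def)
    qed
  qed
  then obtain x0 where x0: "x0 \<in> {0..1}" "\<And>x. x \<in> {0..1} \<Longrightarrow> h x0 \<le> h x"
    using continuous_attains_inf[of "{0..1}" h] by auto
  show thesis
  proof (rule that)
    show "h x0 > 0" using x0(1) l by (auto simp: h_def positive_parameters_def)
    show "h x0 * x \<le> phi l x" if "x \<in> {0..1}" for x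
      using x0(2)[OF that] that by (cases "x = 0") (auto simp: h_def phi field_simps)
  qed
qed

text \<open>Near \<open>0\<close> closeness of \<open>\<phi>\<^sub>m\<close> to \<open>\<phi>\<^sub>l\<close> would not suffice for positivity; closeness of the derivatives gives
  \<open>\<bar>\<phi>\<^sub>m(x) - \<phi>\<^sub>l(x)\<bar> \<le> C \<bar>m - l\<bar> x\<close>, to be compared with the linear lower bound for \<open>\<phi>\<^sub>l\<close>.\<close>

lemma positive_parameters_open:
  assumes l: "l \<in> positive_parameters"
  obtains m where "l < m" "m \<in> positive_parameters"
proof -
  obtain \<kappa> where \<kappa>: "\<kappa> > 0" "\<And>x. x \<in> {0..1} \<Longrightarrow> \<kappa> * x \<le> phi l x"
    using phi_ge_linear[OF l] by blast
  obtain C where C: "C > 0" "\<And>m x. \<lbrakk>\<bar>m - l\<bar> \<le> 1; x \<in> {0..1}\<rbrakk> \<Longrightarrow> \<bar>dphi m x - dphi l x\<bar> \<le> C * \<bar>m - l\<bar>"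
    using phi_Lipschitz[of l] by metis
  define d where "d = min 1 (\<kappa> / (2 * C))"
  have d: "0 < d" "d \<le> 1" "C * d < \<kappa>"
    using C(1) \<kappa>(1) by (auto simp: d_def min_def field_simps)
  have "0 < phi (l + d) x" if x: "x \<in> {0<..1}" for x
  proof -
    have "((\<lambda>u. phi (l + d) u - phi l u) has_real_derivative dphi (l + d) u - dphi l u) (at u within {0..1})"
      if "u \<in> {0..1}" for u
      using solvesD(5)[OF phi(1)] that by (intro DERIV_diff) auto
    moreover have "norm (dphi (l + d) u - dphi l u) \<le> C * d" if "u \<in> {0..1}" for u
      using C(2)[of "l + d" u] d that by simp
    ultimately have "norm ((phi (l + d) x - phi l x) - (phi (l + d) 0 - phi l 0)) \<le> C * d * norm (x - 0)"
      using x by (intro field_differentiable_bound[of "{0..1}"]) auto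
    then have "\<bar>phi (l + d) x - phi l x\<bar> \<le> C * d * x" using x by (simp add: phi)
    moreover have "\<kappa> * x \<le> phi l x" using \<kappa>(2)[of x] x by auto
    moreover have "C * d * x < \<kappa> * x" using d x by (intro mult_strict_right_mono) auto
    ultimately show ?thesis by linarith
  qed
  then show thesis
    using that[of "l + d"] d by (auto simp: positive_parameters_def)
qed

definition lam1 :: real where "lam1 = Sup positive_parameters"

lemma less_lam1_positive: "l < lam1 \<Longrightarrow> l \<in> positive_parameters"
  using positive_parameters_nonempty positive_parameters_downward
  unfolding lam1_def by (metis less_cSup_iff equals0D positive_parameters_bdd_above)

lemma lam1_not_positive: "lam1 \<notin> positive_parameters"
  using positive_parameters_open[of lam1] cSup_upper[OF _ positive_parameters_bdd_above]
  unfolding lam1_def by (metis not_le)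

lemma phi_lam1_nonneg:
  assumes "u \<in> {0<..1}"
  shows "0 \<le> phi lam1 u"
proof (rule tendsto_lowerbound)
  show "((\<lambda>l. phi l u) \<longlongrightarrow> phi lam1 u) (at_left lam1)"
    using isCont_phi[of u lam1] assms filterlim_at_split unfolding isCont_def by auto
  show "eventually (\<lambda>l. 0 \<le> phi l u) (at_left lam1)"
    using less_lam1_positive assms
    by (auto simp: eventually_at_filter positive_parameters_def intro!: always_eventually less_imp_le)
qed simp

text \<open>At \<open>l = lam1\<close> an interior zero would be a minimum, hence a double zero, which contradicts the
  Wronskian identity with \<open>chi\<close>.\<close>

lemma phi_pos:
  assumes "l \<le> lam1" "0 < x" "x < 1"
  shows "0 < phi l x"
proof (cases "l < lam1")
  case True
  then show ?thesis using less_lam1_positive[of l] assms by (auto simp: positive_parameters_def)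
next
  case False
  then have l: "l = lam1" using assms by simp
  have "phi lam1 x \<noteq> 0"
  proof
    assume 0: "phi lam1 x = 0"
    have "dphi lam1 x = 0"
    proof (rule DERIV_local_min[OF phi_DERIV])
      show "0 < min x (1 - x)" using assms by simp
      show "\<forall>y. \<bar>x - y\<bar> < min x (1 - x) \<longrightarrow> phi lam1 x \<le> phi lam1 y"
        unfolding 0 by (intro allI impI phi_lam1_nonneg) (auto simp: abs_if split: if_splits)
    qed (use assms in auto)
    with 0 show False using Wronskian_phi_chi[of x lam1] assms by simp
  qed
  then show ?thesis using phi_lam1_nonneg[of x] assms l by force
qed

lemma phi_lam1_1: "phi lam1 1 = 0"
proof -
  have "\<not> 0 < phi lam1 1"
  proof
    assume "0 < phi lam1 1"
    then have "lam1 \<in> positive_parameters"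
      using phi_pos[OF order.refl] unfolding positive_parameters_def by (auto simp: order_le_less)
    then show False using lam1_not_positive by blast
  qed
  then show ?thesis using phi_lam1_nonneg[of 1] by simp
qed

lemma phi_1_pos: "l < lam1 \<Longrightarrow> 0 < phi l 1"
  using less_lam1_positive by (auto simp: positive_parameters_def)

lemma dphi_lam1_1: "dphi lam1 1 < 0"
  by (rule dphi_neg_at_zero) (auto simp: phi_lam1_1 phi_pos)

lemma psi_lam1: "psi lam1 x = phi lam1 x / - dphi lam1 1"
proof -
  have "chi lam1 1 = 1 / dphi lam1 1"
    using Wronskian_phi_chi[of 1 lam1] dphi_lam1_1 by (simp add: phi_lam1_1 field_simps)
  then show ?thesis by (simp add: psi_def phi_lam1_1)
qed

text \<open>For \<open>l < lam1\<close> the quotient \<open>\<psi>\<^sub>l/\<phi>\<^sub>l\<close> has the derivative \<open>-\<phi>\<^sub>l(1)/\<phi>\<^sub>l\<^sup>2 < 0\<close> and vanishes at \<open>1\<close>.\<close>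

lemma psi_pos:
  assumes "l \<le> lam1" "0 < x" "x < 1"
  shows "0 < psi l x"
proof (cases "l < lam1")
  case True
  have "psi l 1 / phi l 1 < psi l x / phi l x"
  proof (rule DERIV_neg_imp_decreasing_open[OF assms(3)])
    fix u assume u: "x < u" "u < 1"
    have pos: "0 < phi l u" using phi_pos u assms by auto
    have "((\<lambda>u. psi l u / phi l u) has_real_derivative
        (dpsi l u * phi l u - psi l u * dphi l u) / (phi l u * phi l u)) (at u)"
      using u assms pos by (intro DERIV_divide psi_DERIV phi_DERIV) auto
    moreover have "dpsi l u * phi l u - psi l u * dphi l u = - phi l 1"
      using Wronskian_phi_psi[of u l] u assms by (simp add: algebra_simps)
    ultimately show "\<exists>y. ((\<lambda>u. psi l u / phi l u) has_real_derivative y) (at u) \<and> y < 0"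
      using phi_1_pos[OF True] pos by (intro exI[of _ "- phi l 1 / (phi l u * phi l u)"]) auto
  next
    have "phi l u \<noteq> 0" if "u \<in> {x..1}" for u
      using phi_pos[of l u] phi_1_pos[OF True] that assms by (cases "u = 1") auto
    then show "continuous_on {x..1} (\<lambda>u. psi l u / phi l u)"
      using solvesD(3)[OF phi(1)[of l]] solvesD(3)[OF psi(1)[of l]] assms
      by (intro continuous_on_divide) (auto intro: continuous_on_subset)
  qed
  then show ?thesis using phi_pos[OF assms] by (simp add: psi zero_less_divide_iff)
next
  case False
  then have "l = lam1" using assms by simp
  then show ?thesis using phi_pos[OF assms] dphi_lam1_1 by (simp add: psi_lam1 divide_pos_neg)
qed

section \<open>Characteristic equations of the Dirichlet problems\<close>

lemma solves_if_equation_AE: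
  assumes "0 \<le> a" "b \<le> 1"
    and deriv: "\<And>x. x \<in> {a..b} \<Longrightarrow> (y has_real_derivative z x) (at x within {0..1})"
    and ac: "abs_continuous_on {a..b} z"
    and eq: "AE x\<in>{0..1} in lebesgue. \<exists>z'. (z has_real_derivative z') (at x) \<and> - z' + q x * y x = l * w x * y x"
  shows "solves (p l) y z a b"
  unfolding solves_def has_ae_deriv_def
proof (intro conjI ballI)
  show "(y has_real_derivative z x) (at x within {a..b})" if "x \<in> {a..b}" for x
    using deriv[OF that] by (rule DERIV_subset) (use assms(1,2) in auto)
  show "AE x\<in>{a..b} in lebesgue. (z has_real_derivative p l x * y x) (at x)"
    using eq
  proof eventually_elim
    case (elim x)
    show ?case
    proof
      assume "x \<in> {a..b}"
      then have "x \<in> {0..1}" using assms(1,2) by auto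
      then obtain z' where z': "(z has_real_derivative z') (at x)" "- z' + q x * y x = l * w x * y x"
        using elim by blast
      have "z' = p l x * y x" using z'(2) by (simp add: algebra_simps)
      with z'(1) show "(z has_real_derivative p l x * y x) (at x)" by simp
    qed
  qed
qed (rule ac)

lemma AE_equation_if_solves:
  assumes "solves (p l) y z 0 1"
  shows "AE x\<in>{0..1} in lebesgue. \<exists>z'. (z has_real_derivative z') (at x) \<and> - z' + q x * y x = l * w x * y x"
  using has_ae_derivD(2)[OF solvesD(2)[OF assms]]
  by eventually_elim (auto simp: algebra_simps intro!: exI)

lemma dirichlet_eigenvalue_iff: "dirichlet_eigenvalue w q l \<longleftrightarrow> phi l 1 = 0"
proof
  assume "dirichlet_eigenvalue w q l"
  then obtain y z x where y: "\<forall>x\<in>{0..1}. (y has_real_derivative z x) (at x within {0..1})"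
    "abs_continuous_on {0..1} z"
    "AE x\<in>{0..1} in lebesgue. \<exists>z'. (z has_real_derivative z') (at x) \<and> - z' + q x * y x = l * w x * y x"
    "y 0 = 0" "y 1 = 0" and x: "x \<in> {0..1}" "y x \<noteq> 0"
    unfolding dirichlet_eigenvalue_def dirichlet_solution_def by blast
  have "solves (p l) y z 0 1" by (rule solves_if_equation_AE) (use y in auto)
  from solution_lincomb_phi_chi(1)[OF this, of 0] have "y u = z 0 * phi l u" if "u \<in> {0..1}" for u
    using that by (simp add: phi chi y)
  then show "phi l 1 = 0" using x y(5) by force
next
  assume "phi l 1 = 0"
  have "\<exists>x\<in>{0..1}. phi l x \<noteq> 0"
  proof (rule ccontr)
    assume "\<not> ?thesis"
    then have z: "phi l u = 0" if "u \<in> {0..1}" for u using that by blast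
    have "dphi l (1 / 2) = 0"
      by (rule DERIV_local_min[OF phi_DERIV, of "1 / 2" "1 / 2"]) (auto simp: z abs_if split: if_splits)
    then show False using Wronskian_phi_chi[of "1 / 2" l] z[of "1 / 2"] by simp
  qed
  moreover have "dirichlet_solution w q l (phi l)"
    unfolding dirichlet_solution_def
    using solvesD(5)[OF phi(1)[of l]] has_ae_derivD(1)[OF solvesD(1)[OF phi(1)[of l]]]
      has_ae_derivD(1)[OF solvesD(2)[OF phi(1)[of l]]] AE_equation_if_solves[OF phi(1)] phi(2) \<open>phi l 1 = 0\<close>
    by blast
  ultimately show "dirichlet_eigenvalue w q l" unfolding dirichlet_eigenvalue_def by blast
qed

text \<open>On the left of \<open>t\<close> the solution is \<open>y'(0) \<phi>\<^sub>l\<close>, on the right it is \<open>-y'(1) \<psi>\<^sub>l\<close>.  Continuity of \<open>y\<close> and the jump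
  condition at \<open>t\<close> form a homogeneous linear system for these two factors whose determinant \<open>D\<close> is
  \<open>\<phi>\<^sub>l(1) - r \<phi>\<^sub>l(t) \<psi>\<^sub>l(t)\<close>; the factors are not both zero.\<close>

lemma delta_eigenvalue_imp:
  assumes t: "0 < t" "t < 1" and ev: "delta_dirichlet_eigenvalue w q t r l"
  shows "phi l 1 = r * (phi l t * psi l t)"
proof -
  from ev obtain y z L R x0 where
    y: "abs_continuous_on {0..1} y" "y 0 = 0" "y 1 = 0"
    and deriv: "\<And>x. x \<in> {0..1} - {t} \<Longrightarrow> (y has_real_derivative z x) (at x within {0..1})"
    and ac: "abs_continuous_on {0..<t} z" "abs_continuous_on {t<..1} z"
    and lim: "(z \<longlongrightarrow> L) (at_left t)" "(z \<longlongrightarrow> R) (at_right t)" "L - R = r * y t"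
    and eq: "AE x\<in>{0..1} in lebesgue. \<exists>z'. (z has_real_derivative z') (at x) \<and> - z' + q x * y x = l * w x * y x"
    and x0: "x0 \<in> {0..1}" "y x0 \<noteq> 0"
    unfolding delta_dirichlet_eigenvalue_def delta_dirichlet_solution_def by blast
  have left: "y x = z 0 * phi l x" "z x = z 0 * dphi l x" if "0 \<le> x" "x < t" for x
  proof -
    have "solves (p l) y z 0 x"
      by (rule solves_if_equation_AE[OF _ _ deriv _ eq])
        (use that t in \<open>auto intro: abs_continuous_on_subset[OF ac(1)]\<close>)
    from solution_lincomb_phi_chi[OF this, of 0 x] that t
    show "y x = z 0 * phi l x" "z x = z 0 * dphi l x" by (auto simp: phi chi y)
  qed
  have right: "y x = - z 1 * psi l x" "z x = - z 1 * dpsi l x" if "t < x" "x \<le> 1" for x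
  proof -
    have "solves (p l) y z x 1"
      by (rule solves_if_equation_AE[OF _ _ deriv _ eq])
        (use that t in \<open>auto intro: abs_continuous_on_subset[OF ac(2)]\<close>)
    from solution_lincomb_phi_chi[OF this, of 1 x] that t
    show "y x = - z 1 * psi l x" "z x = - z 1 * dpsi l x"
      by (auto simp: y psi_def dpsi_def algebra_simps)
  qed
  have near_left: "eventually (\<lambda>x. x \<in> {0..<t}) (at_left t)"
    using t eventually_at_left_real[of 0 t] by (auto elim: eventually_mono)
  have near_right: "eventually (\<lambda>x. x \<in> {t<..1}) (at_right t)"
    using t eventually_at_right_real[of t 1] by (auto elim: eventually_mono)
  have isc: "isCont y t" "isCont (phi l) t" "isCont (dphi l) t" "isCont (psi l) t" "isCont (dpsi l) t"
    using abs_continuous_on_imp_continuous_on[OF y(1)] solvesD(3,4)[OF phi(1)[of l]] solvesD(3,4)[OF psi(1)[of l]] t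
    by (auto intro!: continuous_on_interior)
  have tends: "(f \<longlongrightarrow> f t) (at_left t)" "(f \<longlongrightarrow> f t) (at_right t)" if "isCont f t" for f :: "real \<Rightarrow> real"
    using that filterlim_at_split unfolding isCont_def by auto
  have ev_left: "eventually (\<lambda>x. z 0 * phi l x = y x) (at_left t)"
    "eventually (\<lambda>x. z 0 * dphi l x = z x) (at_left t)"
    by (rule eventually_mono[OF near_left], rule left[symmetric], force, force)+
  have ev_right: "eventually (\<lambda>x. - z 1 * psi l x = y x) (at_right t)"
    "eventually (\<lambda>x. - z 1 * dpsi l x = z x) (at_right t)"
    by (rule eventually_mono[OF near_right], rule right[symmetric], force, force)+
  have yl: "y t = z 0 * phi l t"
  proof (rule tendsto_unique[OF _ tends(1)[OF isc(1)]])
    show "(y \<longlongrightarrow> z 0 * phi l t) (at_left t)"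
      by (rule Lim_transform_eventually[OF tendsto_mult_left[OF tends(1)[OF isc(2)]] ev_left(1)])
  qed simp
  have yr: "y t = - z 1 * psi l t"
  proof (rule tendsto_unique[OF _ tends(2)[OF isc(1)]])
    show "(y \<longlongrightarrow> - z 1 * psi l t) (at_right t)"
      by (rule Lim_transform_eventually[OF tendsto_mult_left[OF tends(2)[OF isc(4)]] ev_right(1)])
  qed simp
  have L: "L = z 0 * dphi l t"
  proof (rule tendsto_unique[OF _ lim(1)])
    show "(z \<longlongrightarrow> z 0 * dphi l t) (at_left t)"
      by (rule Lim_transform_eventually[OF tendsto_mult_left[OF tends(1)[OF isc(3)]] ev_left(2)])
  qed simp
  have R: "R = - z 1 * dpsi l t"
  proof (rule tendsto_unique[OF _ lim(2)])
    show "(z \<longlongrightarrow> - z 1 * dpsi l t) (at_right t)"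
      by (rule Lim_transform_eventually[OF tendsto_mult_left[OF tends(2)[OF isc(5)]] ev_right(2)])
  qed simp
  define D where "D = (dphi l t * psi l t - phi l t * dpsi l t) - r * (phi l t * psi l t)"
  have "z 0 \<noteq> 0 \<or> z 1 \<noteq> 0"
  proof (rule ccontr)
    assume "\<not> ?thesis"
    then have "y x0 = 0" using left(1)[of x0] right(1)[of x0] yl x0(1) by (cases "x0 < t"; cases "x0 = t") auto
    with x0 show False by simp
  qed
  moreover have "z 0 * D = 0"
  proof -
    have "z 0 * D = (L - r * y t) * psi l t - y t * dpsi l t"
      unfolding D_def L yl by (simp add: algebra_simps)
    also have "L - r * y t = R" using lim(3) by simp
    also have "R * psi l t - y t * dpsi l t = 0" unfolding R yr by simp
    finally show ?thesis .
  qed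
  moreover have "z 1 * D = 0"
  proof -
    have "- z 1 * D = dphi l t * y t - phi l t * (R + r * y t)"
      unfolding D_def R yr by (simp add: algebra_simps)
    also have "R + r * y t = L" using lim(3) by simp
    also have "dphi l t * y t - phi l t * L = 0" unfolding L yl by simp
    finally show ?thesis by simp
  qed
  ultimately have "D = 0" by auto
  then show ?thesis using Wronskian_phi_psi[of t l] t by (simp add: D_def)
qed

text \<open>The eigenfunction is \<open>\<psi>\<^sub>l(t) \<phi>\<^sub>l\<close> on the left and \<open>\<phi>\<^sub>l(t) \<psi>\<^sub>l\<close> on the right of \<open>t\<close>; up to a factor this is
  Green's function with pole \<open>t\<close>.\<close>

lemma delta_eigenvalueI:
  assumes t: "0 < t" "t < 1" and eq: "phi l 1 = r * (phi l t * psi l t)" and nz: "phi l t * psi l t \<noteq> 0"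
  shows "delta_dirichlet_eigenvalue w q t r l"
proof -
  define y where "y = (\<lambda>x. if x \<le> t then psi l t * phi l x else phi l t * psi l x)"
  define z where "z = (\<lambda>x. if x \<le> t then psi l t * dphi l x else phi l t * dpsi l x)"
  have scale: "solves (p l) (\<lambda>x. c * f x) (\<lambda>x. c * g x) 0 1" if "solves (p l) f g 0 1" for c f g
    using solves_lincomb[OF that that, of c 0] by simp
  have S1: "solves (p l) (\<lambda>x. psi l t * phi l x) (\<lambda>x. psi l t * dphi l x) 0 1" (is "solves _ ?y1 ?z1 _ _")
    by (rule scale[OF phi(1)])
  have S2: "solves (p l) (\<lambda>x. phi l t * psi l x) (\<lambda>x. phi l t * dpsi l x) 0 1" (is "solves _ ?y2 ?z2 _ _")
    by (rule scale[OF psi(1)])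
  obtain B where B: "B > 0" "\<And>x. x \<in> {0..1} \<Longrightarrow> \<bar>?z1 x\<bar> \<le> B"
    using abs_continuous_on_bounded[OF has_ae_derivD(1)[OF solvesD(2)[OF S1]]] by blast
  obtain B' where B': "B' > 0" "\<And>x. x \<in> {0..1} \<Longrightarrow> \<bar>?z2 x\<bar> \<le> B'"
    using abs_continuous_on_bounded[OF has_ae_derivD(1)[OF solvesD(2)[OF S2]]] by blast
  have lip1: "\<bar>?y1 v - ?y1 u\<bar> \<le> (B + B') * (v - u)" if "u \<in> {0..1}" "v \<in> {0..1}" "u \<le> v" for u v
  proof -
    have "\<bar>?y1 v - ?y1 u\<bar> \<le> B * \<bar>v - u\<bar>"
      using field_differentiable_bound[of "{0..1}" ?y1 ?z1 B v u] solvesD(5)[OF S1] B(2) that by auto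
    also have "\<dots> \<le> (B + B') * (v - u)" using B'(1) that by (auto intro: mult_right_mono)
    finally show ?thesis .
  qed
  have lip2: "\<bar>?y2 v - ?y2 u\<bar> \<le> (B + B') * (v - u)" if "u \<in> {0..1}" "v \<in> {0..1}" "u \<le> v" for u v
  proof -
    have "\<bar>?y2 v - ?y2 u\<bar> \<le> B' * \<bar>v - u\<bar>"
      using field_differentiable_bound[of "{0..1}" ?y2 ?z2 B' v u] solvesD(5)[OF S2] B'(2) that by auto
    also have "\<dots> \<le> (B + B') * (v - u)" using B(1) that by (auto intro: mult_right_mono)
    finally show ?thesis .
  qed
  have acy: "abs_continuous_on {0..1} y"
  proof (rule abs_continuous_on_lipschitz)
    fix u v :: real assume uv: "u \<in> {0..1}" "v \<in> {0..1}" "u \<le> v"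
    consider "v \<le> t" | "t < u" | "u \<le> t" "t < v" by linarith
    then show "\<bar>y v - y u\<bar> \<le> (B + B') * \<bar>v - u\<bar>"
    proof cases
      case 3
      have "y v - y u = (?y2 v - ?y2 t) + (?y1 t - ?y1 u)" using 3 by (simp add: y_def)
      then have "\<bar>y v - y u\<bar> \<le> \<bar>?y2 v - ?y2 t\<bar> + \<bar>?y1 t - ?y1 u\<bar>"
        by (simp only: abs_triangle_ineq)
      also have "\<dots> \<le> (B + B') * (v - t) + (B + B') * (t - u)"
        using uv 3 t by (intro add_mono lip1 lip2) auto
      finally show ?thesis using uv by (simp add: algebra_simps)
    qed (use uv lip1[OF uv] lip2[OF uv] in \<open>auto simp: y_def\<close>)
  qed
  have deriv: "(y has_real_derivative z x) (at x within {0..1})" if "x \<in> {0..1} - {t}" for x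
  proof (cases "x < t")
    case True
    have "(?y1 has_real_derivative ?z1 x) (at x within {0..1})" using solvesD(5)[OF S1, of x] that by auto
    then have "(y has_real_derivative ?z1 x) (at x within {0..1})"
      by (rule has_field_derivative_transform_within[where d = "t - x"])
        (use that True in \<open>auto simp: y_def dist_real_def\<close>)
    then show ?thesis using True by (simp add: z_def)
  next
    case False
    have "(?y2 has_real_derivative ?z2 x) (at x within {0..1})" using solvesD(5)[OF S2, of x] that by auto
    then have "(y has_real_derivative ?z2 x) (at x within {0..1})"
      by (rule has_field_derivative_transform_within[where d = "x - t"])
        (use that False in \<open>auto simp: y_def dist_real_def\<close>)
    then show ?thesis using False that by (simp add: z_def)
  qed
  have acz: "abs_continuous_on {0..<t} z" "abs_continuous_on {t<..1} z"
  proof -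
    have "abs_continuous_on {0..<t} ?z1" "abs_continuous_on {t<..1} ?z2"
      using t by (auto intro: abs_continuous_on_subset[OF has_ae_derivD(1)[OF solvesD(2)[OF S1]]]
          abs_continuous_on_subset[OF has_ae_derivD(1)[OF solvesD(2)[OF S2]]])
    then show "abs_continuous_on {0..<t} z" "abs_continuous_on {t<..1} z"
      by (auto elim!: abs_continuous_on_cong simp: z_def)
  qed
  have isc: "isCont ?z1 t" "isCont ?z2 t"
    using solvesD(4)[OF S1] solvesD(4)[OF S2] t by (auto intro!: continuous_on_interior)
  have lim: "(z \<longlongrightarrow> ?z1 t) (at_left t)" "(z \<longlongrightarrow> ?z2 t) (at_right t)"
  proof -
    have z12: "(?z1 \<longlongrightarrow> ?z1 t) (at_left t)" "(?z2 \<longlongrightarrow> ?z2 t) (at_right t)"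
      using isc filterlim_at_split unfolding isCont_def by auto
    show "(z \<longlongrightarrow> ?z1 t) (at_left t)"
      by (rule Lim_transform_eventually[OF z12(1)])
        (auto simp: z_def eventually_at_filter intro!: always_eventually)
    show "(z \<longlongrightarrow> ?z2 t) (at_right t)"
      by (rule Lim_transform_eventually[OF z12(2)])
        (auto simp: z_def eventually_at_filter intro!: always_eventually)
  qed
  have "AE x\<in>{0..1} in lebesgue. \<exists>z'. (z has_real_derivative z') (at x) \<and> - z' + q x * y x = l * w x * y x"
  proof -
    have "AE x in lebesgue. x \<notin> {t}"
      by (rule AE_lebesgue_notin_finite) simp
    with AE_equation_if_solves[OF S1] AE_equation_if_solves[OF S2] show ?thesis
    proof eventually_elim
      case (elim x)
      show ?case
      proof
        assume x: "x \<in> {0..1}"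
        show "\<exists>z'. (z has_real_derivative z') (at x) \<and> - z' + q x * y x = l * w x * y x"
        proof (cases "x < t")
          case True
          obtain z' where z': "(?z1 has_real_derivative z') (at x)" "- z' + q x * ?y1 x = l * w x * ?y1 x"
            using elim(1) x by blast
          have "(z has_real_derivative z') (at x)"
            by (rule has_field_derivative_transform_within[OF z'(1), of "t - x"])
              (use True in \<open>auto simp: z_def dist_real_def\<close>)
          then show ?thesis using z'(2) True by (auto simp: y_def)
        next
          case False
          then have "t < x" using elim(3) by auto
          obtain z' where z': "(?z2 has_real_derivative z') (at x)" "- z' + q x * ?y2 x = l * w x * ?y2 x"
            using elim(2) x by blast
          have "(z has_real_derivative z') (at x)"
            by (rule has_field_derivative_transform_within[OF z'(1), of "x - t"])
              (use \<open>t < x\<close> in \<open>auto simp: z_def dist_real_def\<close>)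
          then show ?thesis using z'(2) \<open>t < x\<close> by (auto simp: y_def)
        qed
      qed
    qed
  qed
  moreover have "?z1 t - ?z2 t = r * y t"
    using Wronskian_phi_psi[of t l] eq t by (simp add: y_def algebra_simps)
  moreover have "y 0 = 0" "y 1 = 0" using t by (simp_all add: y_def phi psi)
  ultimately have "delta_dirichlet_solution w q t r l y"
    unfolding delta_dirichlet_solution_def using acy deriv acz lim by blast
  moreover have "y t \<noteq> 0" using nz by (simp add: y_def)
  ultimately show ?thesis
    unfolding delta_dirichlet_eigenvalue_def using t by (intro exI[of _ y] conjI bexI[of _ t]) auto
qed

lemma dirichlet_eigenvalue_lam1: "dirichlet_eigenvalue w q lam1"
  by (simp add: dirichlet_eigenvalue_iff phi_lam1_1)

lemma lam1_le_dirichlet_eigenvalue: "dirichlet_eigenvalue w q l \<Longrightarrow> lam1 \<le> l"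
  using phi_1_pos[of l] by (force simp: dirichlet_eigenvalue_iff)

lemma first_dirichlet_eigenvalue_eq: "first_dirichlet_eigenvalue w q = lam1"
  unfolding first_dirichlet_eigenvalue_def
  by (intro Least_equality dirichlet_eigenvalue_lam1 lam1_le_dirichlet_eigenvalue)

lemma phi_psi_pos: "l \<le> lam1 \<Longrightarrow> 0 < t \<Longrightarrow> t < 1 \<Longrightarrow> 0 < phi l t * psi l t"
  by (simp add: phi_pos psi_pos)

lemma first_eigenvalue_function_0:
  assumes t: "0 < t" "t < 1"
  shows "first_eigenvalue_function w q t 0 = lam1"
  unfolding first_eigenvalue_function_def
proof (rule Least_equality)
  show "delta_dirichlet_eigenvalue w q t 0 lam1"
    using phi_psi_pos[of lam1 t] t by (intro delta_eigenvalueI) (auto simp: phi_lam1_1)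
  show "lam1 \<le> l" if "delta_dirichlet_eigenvalue w q t 0 l" for l
    using delta_eigenvalue_imp[OF t that] lam1_le_dirichlet_eigenvalue[of l]
    by (simp add: dirichlet_eigenvalue_iff)
qed

section \<open>Dependence of the first eigenvalue on the coupling constant\<close>

text \<open>For \<open>l \<le> lam1\<close> this is the strength \<open>r\<close> of the point interaction at \<open>t\<close> that makes \<open>l\<close> an eigenvalue; it is
  the reciprocal of Green's function at \<open>(t, t)\<close>.\<close>

definition coupling :: "real \<Rightarrow> real \<Rightarrow> real" where
  "coupling t l = phi l 1 / (phi l t * psi l t)"

text \<open>The difference of the two sides is \<open>(l - m) \<integral> w \<phi>\<^sub>m \<phi>\<^sub>l\<close> over \<open>[0, t]\<close>; in other words, \<open>\<phi>\<^sub>l'(t)/\<phi>\<^sub>l(t)\<close> strictly decreases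
  in \<open>l\<close>.\<close>

lemma phi_Wronskian_less:
  assumes "m < l" "l \<le> lam1" "0 < t" "t < 1"
  shows "dphi l t * phi m t < dphi m t * phi l t"
proof -
  have int: "(\<lambda>x. w x * (phi m x * phi l x)) absolutely_integrable_on {0..1}"
    by (intro absolutely_integrable_continuous_mult w continuous_intros solvesD(3)[OF phi(1)])
  have I: "has_ae_deriv (\<lambda>x. (l - m) * integral {0..x} (\<lambda>x. w x * (phi m x * phi l x)))
     (\<lambda>x. 0 * integral {0..x} (\<lambda>x. w x * (phi m x * phi l x)) + (l - m) * (w x * (phi m x * phi l x))) 0 t"
    by (rule has_ae_deriv_subset[OF has_ae_deriv_mult[OF has_ae_deriv_const has_ae_deriv_integral[OF int]]])
      (use assms in auto)
  have W: "has_ae_deriv (\<lambda>x. dphi m x * phi l x - phi m x * dphi l x) (\<lambda>x. (p m x - p l x) * (phi m x * phi l x)) 0 t"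
    by (rule has_ae_deriv_subset[OF has_ae_deriv_Wronskian[OF phi(1) phi(1)]]) (use assms in auto)
  have W_eq: "dphi m t * phi l t - phi m t * dphi l t = (l - m) * integral {0..t} (\<lambda>x. w x * (phi m x * phi l x))"
    using has_ae_deriv_eq_imp_diff_eq[OF W I] assms by (auto simp: phi algebra_simps)
  have "0 < integral {0..t} (\<lambda>x. w x * (phi m x * phi l x))"
  proof (rule integral_pos_AE)
    show "(\<lambda>x. w x * (phi m x * phi l x)) absolutely_integrable_on {0..t}"
      using int by (rule set_integrable_subset) (use assms in auto)
    have "AE x in lebesgue. x \<notin> {0 :: real}"
      by (rule AE_lebesgue_notin_finite) simp
    with w_pos show "AE x\<in>{0..t} in lebesgue. 0 < w x * (phi m x * phi l x)"
    proof eventually_elim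
      case (elim x)
      then show ?case using assms phi_pos[of m x] phi_pos[of l x] by auto
    qed
  qed (use assms in auto)
  then have "0 < (l - m) * integral {0..t} (\<lambda>x. w x * (phi m x * phi l x))"
    using assms by (intro mult_pos_pos) auto
  then have "phi m t * dphi l t < dphi m t * phi l t" using W_eq by linarith
  then show ?thesis by (simp only: mult.commute[of "dphi l t"])
qed

text \<open>The counterpart on \<open>[t, 1]\<close>: \<open>\<psi>\<^sub>l'(t)/\<psi>\<^sub>l(t)\<close> does not decrease in \<open>l\<close>.\<close>

lemma psi_Wronskian_le:
  assumes "m < l" "l \<le> lam1" "0 < t" "t < 1"
  shows "dpsi m t * psi l t \<le> dpsi l t * psi m t"
proof -
  have "has_ae_deriv (\<lambda>x. dpsi m x * psi l x - psi m x * dpsi l x) (\<lambda>x. (p m x - p l x) * (psi m x * psi l x)) t 1"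
    by (rule has_ae_deriv_subset[OF has_ae_deriv_Wronskian[OF psi(1) psi(1)]]) (use assms in auto)
  then have "dpsi m t * psi l t - psi m t * dpsi l t \<le> dpsi m 1 * psi l 1 - psi m 1 * dpsi l 1"
  proof (rule has_ae_deriv_nonneg_imp_le)
    show "AE x\<in>{t..1} in lebesgue. 0 \<le> (p m x - p l x) * (psi m x * psi l x)"
      using w_pos
    proof eventually_elim
      case (elim x)
      have "p m x - p l x = (l - m) * w x" by (simp add: algebra_simps)
      then show ?case
        using elim assms psi_pos[of m x] psi_pos[of l x] psi(2)[of l] by (cases "x = 1") (auto intro: less_imp_le)
    qed
  qed (use assms in auto)
  then show ?thesis by (simp add: psi algebra_simps)
qed

text \<open>By the Wronskian of \<open>\<phi>\<^sub>l\<close> and \<open>\<psi>\<^sub>l\<close>, the coupling is \<open>\<phi>\<^sub>l'(t)/\<phi>\<^sub>l(t) - \<psi>\<^sub>l'(t)/\<psi>\<^sub>l(t)\<close>.\<close>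

lemma coupling_strict_antimono:
  assumes "m < l" "l \<le> lam1" "0 < t" "t < 1"
  shows "coupling t l < coupling t m"
proof -
  have eq: "coupling t k = dphi k t / phi k t - dpsi k t / psi k t" if "k \<le> lam1" for k
    using Wronskian_phi_psi[of t k] phi_pos[OF that, of t] psi_pos[OF that, of t] assms
    by (simp add: coupling_def field_simps)
  have pos: "0 < phi l t" "0 < phi m t" "0 < psi l t" "0 < psi m t"
    using assms by (auto intro!: phi_pos psi_pos)
  have "dphi l t / phi l t < dphi m t / phi m t"
    using phi_Wronskian_less[OF assms] pos by (simp add: divide_simps)
  moreover have "dpsi m t / psi m t \<le> dpsi l t / psi l t"
    using psi_Wronskian_le[OF assms] pos by (simp add: divide_simps)
  ultimately show ?thesis using assms by (simp add: eq)
qed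

lemma isCont_coupling:
  assumes "l \<le> lam1" "0 < t" "t < 1"
  shows "isCont (coupling t) l"
  unfolding coupling_def using phi_psi_pos[OF assms] assms
  by (intro continuous_intros isCont_phi isCont_psi) auto

text \<open>The intermediate value theorem between \<open>l0\<close> and \<open>lam1\<close>, where the coupling is zero, produces an eigenvalue, and
  strict monotonicity excludes a smaller one.\<close>

lemma first_eigenvalue_function_small:
  assumes t: "0 < t" "t < 1" and l0: "l0 < lam1" and r: "0 < r" "r < coupling t l0"
  obtains l where "l0 < l" "l < lam1" "coupling t l = r" "first_eigenvalue_function w q t r = l"
proof -
  have c1: "coupling t lam1 = 0" by (simp add: coupling_def phi_lam1_1)
  obtain l where l: "l0 \<le> l" "l \<le> lam1" "coupling t l = r"
    using IVT2[of "coupling t" lam1 r l0] isCont_coupling t l0 r c1 by auto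
  have "l \<noteq> l0" "l \<noteq> lam1" using l r c1 by auto
  have "first_eigenvalue_function w q t r = l"
    unfolding first_eigenvalue_function_def
  proof (rule Least_equality)
    show "delta_dirichlet_eigenvalue w q t r l"
      using phi_psi_pos[OF l(2) t] l(3) by (intro delta_eigenvalueI t) (auto simp: coupling_def field_simps)
    show "l \<le> m" if ev: "delta_dirichlet_eigenvalue w q t r m" for m
    proof (rule ccontr)
      assume "\<not> l \<le> m"
      then have "m < l" by simp
      have "coupling t m = r"
        using phi_psi_pos[of m t] t l(2) \<open>m < l\<close>
        unfolding coupling_def delta_eigenvalue_imp[OF t ev] by (intro nonzero_mult_div_cancel_right) auto
      then show False using coupling_strict_antimono[OF \<open>m < l\<close> l(2) t] l(3) by simp
    qed
  qed
  then show thesis using that[of l] l \<open>l \<noteq> l0\<close> \<open>l \<noteq> lam1\<close> by simp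
qed

definition weighted_norm_sq :: real where
  "weighted_norm_sq = integral {0..1} (\<lambda>x. w x * (phi lam1 x * phi lam1 x))"

lemma w_phi_int: "(\<lambda>x. w x * (phi l x * phi m x)) absolutely_integrable_on {0..1}"
  by (intro absolutely_integrable_continuous_mult w continuous_intros solvesD(3)[OF phi(1)])

lemma weighted_norm_sq_pos: "0 < weighted_norm_sq"
  unfolding weighted_norm_sq_def
proof (rule integral_pos_AE[OF w_phi_int])
  have "AE x in lebesgue. x \<notin> {0, 1 :: real}"
    by (rule AE_lebesgue_notin_finite) simp
  with w_pos show "AE x\<in>{0..1} in lebesgue. 0 < w x * (phi lam1 x * phi lam1 x)"
  proof eventually_elim
    case (elim x)
    then show ?case using phi_pos[of lam1 x] by auto
  qed
qed simp

text \<open>The Wronskian of \<open>\<phi>\<^sub>l\<close> with the first eigenfunction, integrated over \<open>[0,1]\<close>.  It shows how \<open>\<phi>\<^sub>l(1)\<close> vanishes at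
  \<open>lam1\<close> without differentiating in \<open>l\<close>.\<close>

lemma phi_1_eq:
  "phi l 1 * (- dphi lam1 1) = (lam1 - l) * integral {0..1} (\<lambda>x. w x * (phi l x * phi lam1 x))"
proof -
  have I: "has_ae_deriv (\<lambda>x. (lam1 - l) * integral {0..x} (\<lambda>x. w x * (phi l x * phi lam1 x)))
     (\<lambda>x. 0 * integral {0..x} (\<lambda>x. w x * (phi l x * phi lam1 x)) + (lam1 - l) * (w x * (phi l x * phi lam1 x))) 0 1"
    by (intro has_ae_deriv_mult has_ae_deriv_const has_ae_deriv_integral w_phi_int)
  show ?thesis
    using has_ae_deriv_eq_imp_diff_eq[OF has_ae_deriv_Wronskian[OF phi(1)[of l] phi(1)[of lam1]] I]
    by (auto simp: phi phi_lam1_1 algebra_simps)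
qed

lemma isCont_weighted_product: "isCont (\<lambda>l. integral {0..1} (\<lambda>x. w x * (phi l x * phi lam1 x))) l"
proof -
  obtain C where C: "C > 0" "\<And>m x. \<lbrakk>\<bar>m - l\<bar> \<le> 1; x \<in> {0..1}\<rbrakk> \<Longrightarrow> \<bar>phi m x - phi l x\<bar> \<le> C * \<bar>m - l\<bar>"
    using phi_Lipschitz[of l] by metis
  obtain B where B: "B > 0" "\<And>x. x \<in> {0..1} \<Longrightarrow> \<bar>phi lam1 x\<bar> \<le> B"
    using abs_continuous_on_bounded[OF has_ae_derivD(1)[OF solvesD(1)[OF phi(1)]]] by blast
  have int: "(\<lambda>x. w x * (phi m x * phi lam1 x)) integrable_on {0..1}" for m
    using w_phi_int by (simp add: absolutely_integrable_on_def)
  have wint: "(\<lambda>x. \<bar>w x\<bar>) integrable_on {0..1}"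
    using set_integrable_abs[OF w] by (simp add: absolutely_integrable_on_def)
  show ?thesis
  proof (rule Lipschitz_at_imp_isCont)
    fix m :: real assume m: "\<bar>m - l\<bar> \<le> 1"
    have "\<bar>integral {0..1} (\<lambda>x. w x * (phi m x * phi lam1 x)) - integral {0..1} (\<lambda>x. w x * (phi l x * phi lam1 x))\<bar>
      = norm (integral {0..1} (\<lambda>x. w x * (phi m x * phi lam1 x) - w x * (phi l x * phi lam1 x)))"
      using int by (simp add: Henstock_Kurzweil_Integration.integral_diff)
    also have "\<dots> \<le> integral {0..1} (\<lambda>x. \<bar>w x\<bar> * (C * \<bar>m - l\<bar> * B))"
    proof (rule integral_norm_bound_integral)
      fix x :: real assume x: "x \<in> {0..1}"
      have "norm (w x * (phi m x * phi lam1 x) - w x * (phi l x * phi lam1 x))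
          = \<bar>w x\<bar> * (\<bar>phi m x - phi l x\<bar> * \<bar>phi lam1 x\<bar>)"
        by (simp add: abs_mult flip: right_diff_distrib left_diff_distrib)
      also have "\<dots> \<le> \<bar>w x\<bar> * (C * \<bar>m - l\<bar> * B)"
        using C(1) by (intro mult_left_mono mult_mono C(2)[OF m x] B(2)[OF x]) auto
      finally show "norm (w x * (phi m x * phi lam1 x) - w x * (phi l x * phi lam1 x)) \<le> \<bar>w x\<bar> * (C * \<bar>m - l\<bar> * B)" .
    qed (intro integrable_diff int integrable_on_mult_left wint)+
    also have "\<dots> = integral {0..1} (\<lambda>x. \<bar>w x\<bar>) * C * B * \<bar>m - l\<bar>" by simp
    finally show "\<bar>integral {0..1} (\<lambda>x. w x * (phi m x * phi lam1 x)) - integral {0..1} (\<lambda>x. w x * (phi l x * phi lam1 x))\<bar>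
      \<le> integral {0..1} (\<lambda>x. \<bar>w x\<bar>) * C * B * \<bar>m - l\<bar>" .
  qed
qed

lemma gap_over_coupling_tendsto:
  assumes t: "0 < t" "t < 1"
  shows "((\<lambda>l. (lam1 - l) / coupling t l) \<longlongrightarrow> (phi lam1 t)\<^sup>2 / weighted_norm_sq) (at_left lam1)"
proof -
  let ?I = "\<lambda>l. integral {0..1} (\<lambda>x. w x * (phi l x * phi lam1 x))"
  let ?h = "\<lambda>l. phi l t * psi l t * (- dphi lam1 1) / ?I l"
  have "isCont ?h lam1"
    using weighted_norm_sq_pos t by (intro continuous_intros isCont_phi isCont_psi isCont_weighted_product) (auto simp: weighted_norm_sq_def)
  then have "(?h \<longlongrightarrow> ?h lam1) (at_left lam1)"
    using filterlim_at_split unfolding isCont_def by auto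
  moreover have "?h lam1 = (phi lam1 t)\<^sup>2 / weighted_norm_sq"
    using dphi_lam1_1 by (simp add: psi_lam1 weighted_norm_sq_def power2_eq_square)
  moreover have "eventually (\<lambda>l. ?h l = (lam1 - l) / coupling t l) (at_left lam1)"
    unfolding eventually_at_filter
  proof (intro always_eventually allI impI)
    fix l assume "l \<in> {..<lam1}"
    then have l: "l < lam1" by simp
    have I: "(lam1 - l) * ?I l = phi l 1 * (- dphi lam1 1)" by (simp only: phi_1_eq)
    have "0 < phi l 1 * (- dphi lam1 1)"
      using phi_1_pos[OF l] dphi_lam1_1 by (intro mult_pos_pos) auto
    then have "?I l \<noteq> 0" unfolding I[symmetric] by auto
    moreover have "(lam1 - l) * (phi l t * psi l t) * ?I l = phi l t * psi l t * (- dphi lam1 1) * phi l 1"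
      using I by algebra
    ultimately have "(lam1 - l) * (phi l t * psi l t) / phi l 1 = ?h l"
      using phi_1_pos[OF l] by (subst frac_eq_eq) auto
    then show "?h l = (lam1 - l) / coupling t l" by (simp add: coupling_def)
  qed
  ultimately show ?thesis using Lim_transform_eventually by force
qed

text \<open>If \<open>F r\<close> denotes the first eigenvalue, then \<open>r\<close> is the coupling at \<open>F r\<close>, so the difference quotient
  \<open>(F r - F 0) / r\<close> is \<open>- (lam1 - l) / coupling t l\<close> at \<open>l = F r\<close>.  As \<open>r\<close> decreases to zero, \<open>F r\<close> increases to
  \<open>lam1\<close>, where the limit of this expression is known.\<close>

lemma first_eigenvalue_function_has_derivative:
  assumes t: "0 < t" "t < 1"
  shows "((\<lambda>r. first_eigenvalue_function w q t r) has_real_derivative - (phi lam1 t)\<^sup>2 / weighted_norm_sq) (at_right 0)"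
proof -
  let ?F = "\<lambda>r. first_eigenvalue_function w q t r"
  have pos: "0 < coupling t l" if "l < lam1" for l
    using coupling_strict_antimono[OF that order.refl t] by (simp add: coupling_def phi_lam1_1)
  have small: "eventually (\<lambda>r. l0 < ?F r \<and> ?F r < lam1 \<and> coupling t (?F r) = r) (at_right 0)" if l0: "l0 < lam1" for l0
  proof -
    have "eventually (\<lambda>r. r \<in> {0<..<coupling t l0}) (at_right 0)"
      using pos[OF l0] by (rule eventually_at_right_real)
    then show ?thesis
    proof eventually_elim
      case (elim r)
      then show ?case using first_eigenvalue_function_small[OF t l0, of r] by (metis greaterThanLessThan_iff)
    qed
  qed
  have ev: "eventually (\<lambda>r. ?F r < lam1 \<and> coupling t (?F r) = r) (at_right 0)"
    using small[of "lam1 - 1"] by (auto elim: eventually_mono)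
  have "filterlim ?F (at_left lam1) (at_right 0)"
    unfolding filterlim_at
  proof
    show "(?F \<longlongrightarrow> lam1) (at_right 0)"
    proof (rule order_tendstoI)
      show "eventually (\<lambda>r. a < ?F r) (at_right 0)" if "a < lam1" for a
        using small[OF that] by (auto elim: eventually_mono)
      show "eventually (\<lambda>r. ?F r < a) (at_right 0)" if "lam1 < a" for a
        using ev by eventually_elim (use that in auto)
    qed
    show "eventually (\<lambda>r. ?F r \<in> {..<lam1} \<and> ?F r \<noteq> lam1) (at_right 0)"
      using ev by eventually_elim auto
  qed
  from filterlim_compose[OF gap_over_coupling_tendsto[OF t] this]
  have "((\<lambda>r. - ((lam1 - ?F r) / coupling t (?F r))) \<longlongrightarrow> - ((phi lam1 t)\<^sup>2 / weighted_norm_sq)) (at_right 0)"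
    by (rule tendsto_minus)
  then have "((\<lambda>r. (?F r - ?F 0) / (r - 0)) \<longlongrightarrow> - ((phi lam1 t)\<^sup>2 / weighted_norm_sq)) (at_right 0)"
  proof (rule Lim_transform_eventually)
    show "eventually (\<lambda>r. - ((lam1 - ?F r) / coupling t (?F r)) = (?F r - ?F 0) / (r - 0)) (at_right 0)"
      using ev by eventually_elim (simp add: first_eigenvalue_function_0[OF t] minus_divide_left)
  qed
  then show ?thesis by (simp add: has_field_derivative_iff)
qed

section \<open>Recovery of the potential\<close>

lemma first_eigenvalue_r_deriv_eq:
  assumes "0 < t" "t < 1"
  shows "first_eigenvalue_r_deriv w q t = - (phi lam1 t)\<^sup>2 / weighted_norm_sq"
  unfolding first_eigenvalue_r_deriv_def
  using first_eigenvalue_function_has_derivative[OF assms]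
  by (intro vector_derivative_within) (auto simp: has_real_derivative_iff_has_vector_derivative)

lemma phi0_eq:
  assumes "0 < x" "x < 1"
  shows "phi0 w q x = phi lam1 x / sqrt weighted_norm_sq"
  using phi_pos[OF order.refl assms] by (simp add: phi0_def first_eigenvalue_r_deriv_eq[OF assms] real_sqrt_divide)

lemma phi0_has_derivative:
  assumes x: "0 < x" "x < 1"
  shows "(phi0 w q has_real_derivative dphi lam1 x / sqrt weighted_norm_sq) (at x)"
proof -
  have "((\<lambda>x. phi lam1 x / sqrt weighted_norm_sq) has_real_derivative dphi lam1 x / sqrt weighted_norm_sq) (at x)"
    using phi_DERIV[of x lam1] x by (intro DERIV_cdivide) auto
  then show ?thesis
    by (rule has_field_derivative_transform_within_open[where S = "{0<..<1}"]) (use x phi0_eq in auto)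
qed

lemma deriv_phi0: "0 < x \<Longrightarrow> x < 1 \<Longrightarrow> deriv (phi0 w q) x = dphi lam1 x / sqrt weighted_norm_sq"
  by (rule DERIV_imp_deriv[OF phi0_has_derivative])

lemma deriv_phi0_abs_continuous:
  assumes "0 < a" "b < 1"
  shows "abs_continuous_on {a..b} (deriv (phi0 w q))"
proof (rule abs_continuous_on_dominated)
  show "abs_continuous_on {a..b} (dphi lam1)"
    by (rule abs_continuous_on_subset[OF has_ae_derivD(1)[OF solvesD(2)[OF phi(1)]]]) (use assms in auto)
  show "1 / sqrt weighted_norm_sq > 0" using weighted_norm_sq_pos by simp
  show "\<bar>deriv (phi0 w q) v - deriv (phi0 w q) u\<bar> \<le> 1 / sqrt weighted_norm_sq * \<bar>dphi lam1 v - dphi lam1 u\<bar>"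
    if "u \<in> {a..b}" "v \<in> {a..b}" for u v
    using that assms weighted_norm_sq_pos by (simp add: deriv_phi0 flip: diff_divide_distrib)
qed

lemma potential_from_phi0:
  "AE x\<in>{0<..<1} in lebesgue. deriv (phi0 w q) field_differentiable (at x) \<and>
     q x = deriv (deriv (phi0 w q)) x / phi0 w q x + lam1 * w x"
  using has_ae_derivD(2)[OF solvesD(2)[OF phi(1)[of lam1]]]
proof eventually_elim
  case (elim x)
  show ?case
  proof
    assume x: "x \<in> {0<..<1}"
    then have "(dphi lam1 has_real_derivative p lam1 x * phi lam1 x) (at x)" using elim by auto
    then have "((\<lambda>x. dphi lam1 x / sqrt weighted_norm_sq) has_real_derivative p lam1 x * phi lam1 x / sqrt weighted_norm_sq) (at x)"
      by (rule DERIV_cdivide)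
    then have D: "(deriv (phi0 w q) has_real_derivative p lam1 x * phi lam1 x / sqrt weighted_norm_sq) (at x)"
      by (rule has_field_derivative_transform_within_open[where S = "{0<..<1}"]) (use x deriv_phi0 in auto)
    have "deriv (deriv (phi0 w q)) x / phi0 w q x = p lam1 x"
      using DERIV_imp_deriv[OF D] phi0_eq[of x] x phi_pos[of lam1 x] weighted_norm_sq_pos by simp
    then show "deriv (phi0 w q) field_differentiable (at x) \<and>
        q x = deriv (deriv (phi0 w q)) x / phi0 w q x + lam1 * w x"
      using D by (auto simp: field_differentiable_def)
  qed
qed

lemma first_eigenvalue_r_deriv_neg:
  assumes "0 < t" "t < 1"
  shows "first_eigenvalue_r_deriv w q t < 0"
  using phi_pos[OF order.refl assms] weighted_norm_sq_pos by (simp add: first_eigenvalue_r_deriv_eq[OF assms])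

end

text \<open>The eigenvalue functions agree for small \<open>r\<close>, hence so do their derivatives at \<open>r = 0\<close>, and with them
  \<open>phi0\<close> and its derivatives on the open interval.\<close>

lemma potential_determined:
  assumes "weighted_equation q1 w" "weighted_equation q2 w" "0 < eps0"
    and eq: "\<And>t r. \<lbrakk>0 < t; t < 1; 0 \<le> r; r \<le> eps0\<rbrakk> \<Longrightarrow>
      first_eigenvalue_function w q1 t r = first_eigenvalue_function w q2 t r"
  shows "AE x\<in>{0..1} in lebesgue. q1 x = q2 x"
proof -
  interpret E1: weighted_equation q1 w by fact
  interpret E2: weighted_equation q2 w by fact
  have lam: "E1.lam1 = E2.lam1"
    using E1.first_eigenvalue_function_0[of "1 / 2"] E2.first_eigenvalue_function_0[of "1 / 2"]
      eq[of "1 / 2" 0] assms(3) by simp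
  have "first_eigenvalue_r_deriv w q1 t = first_eigenvalue_r_deriv w q2 t" if t: "0 < t" "t < 1" for t
  proof -
    have "((\<lambda>r. first_eigenvalue_function w q2 t r) has_real_derivative - (E1.phi E1.lam1 t)\<^sup>2 / E1.weighted_norm_sq) (at_right 0)"
      using E1.first_eigenvalue_function_has_derivative[OF t]
      unfolding has_field_derivative_iff
    proof (rule Lim_transform_eventually)
      have "eventually (\<lambda>r. r \<in> {0<..<eps0}) (at_right 0)"
        using assms(3) by (rule eventually_at_right_real)
      then show "eventually (\<lambda>r. (first_eigenvalue_function w q1 t r - first_eigenvalue_function w q1 t 0) / (r - 0)
         = (first_eigenvalue_function w q2 t r - first_eigenvalue_function w q2 t 0) / (r - 0)) (at_right 0)"
        by eventually_elim (use eq[OF t] assms(3) in auto)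
    qed
    from tendsto_unique[OF _ this[unfolded has_field_derivative_iff]
        E2.first_eigenvalue_function_has_derivative[OF t, unfolded has_field_derivative_iff]]
    show ?thesis by (simp add: E1.first_eigenvalue_r_deriv_eq[OF t] E2.first_eigenvalue_r_deriv_eq[OF t])
  qed
  then have phi0: "phi0 w q1 x = phi0 w q2 x" if "x \<in> {0<..<1}" for x
    using that by (simp add: phi0_def)
  have cong: "deriv f x = deriv g x" if "x \<in> {0<..<1}" "\<And>u. u \<in> {0<..<1} \<Longrightarrow> f u = g u" for f g :: "real \<Rightarrow> real" and x
    using that by (intro deriv_cong_ev eventually_nhds_in_open[THEN eventually_mono, of "{0<..<1}"]) auto
  have "AE x in lebesgue. x \<notin> {0, 1 :: real}"
    by (rule AE_lebesgue_notin_finite) simp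
  with E1.potential_from_phi0 E2.potential_from_phi0 show ?thesis
  proof eventually_elim
    case (elim x)
    show ?case
    proof
      assume "x \<in> {0..1}"
      then have x: "x \<in> {0<..<1}" using elim(3) by auto
      have "deriv (deriv (phi0 w q1)) x = deriv (deriv (phi0 w q2)) x"
        by (intro cong x phi0)
      then show "q1 x = q2 x" using elim(1,2) x phi0[OF x] lam by auto
    qed
  qed
qed

theorem theorem4p1:
  fixes w :: "real \<Rightarrow> real" and eps0 :: real
  assumes "w absolutely_integrable_on {0..1}"
    and "AE x\<in>{0<..<1} in lebesgue. 0 < w x"
    and "0 < eps0"
  shows "(\<forall>q1 q2 :: real \<Rightarrow> real.
            q1 absolutely_integrable_on {0..1} \<longrightarrow> q2 absolutely_integrable_on {0..1} \<longrightarrow>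
            (\<forall>t\<in>{0<..<1}. \<forall>r\<in>{0..eps0}.
               first_eigenvalue_function w q1 t r = first_eigenvalue_function w q2 t r) \<longrightarrow>
            (AE x\<in>{0..1} in lebesgue. q1 x = q2 x))
       \<and> (\<forall>q :: real \<Rightarrow> real. q absolutely_integrable_on {0..1} \<longrightarrow>
            (let lam1 = first_dirichlet_eigenvalue w q in
               dirichlet_eigenvalue w q lam1 \<and>
               (\<forall>\<mu>. dirichlet_eigenvalue w q \<mu> \<longrightarrow> lam1 \<le> \<mu>) \<and>
               (\<forall>t\<in>{0<..<1}. first_eigenvalue_function w q t 0 = lam1) \<and>
               (\<forall>x\<in>{0<..<1}.
                  ((\<lambda>r. first_eigenvalue_function w q x r) has_real_derivative
                     first_eigenvalue_r_deriv w q x) (at_right 0) \<and>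
                  first_eigenvalue_r_deriv w q x < 0) \<and>
               (\<forall>x\<in>{0<..<1}. phi0 w q field_differentiable (at x)) \<and>
               (\<forall>a b. 0 < a \<and> b < 1 \<longrightarrow> abs_continuous_on {a..b} (deriv (phi0 w q))) \<and>
               (AE x\<in>{0<..<1} in lebesgue.
                  deriv (phi0 w q) field_differentiable (at x) \<and>
                  q x = deriv (deriv (phi0 w q)) x / phi0 w q x + lam1 * w x)))"
proof -
  have "AE x in lebesgue. x \<notin> {0, 1 :: real}"
    by (rule AE_lebesgue_notin_finite) simp
  with assms(2) have pos: "AE x\<in>{0..1} in lebesgue. 0 < w x"
    by eventually_elim auto
  have E: "weighted_equation q w" if "q absolutely_integrable_on {0..1}" for q
    using that assms(1) pos by unfold_locales
  show ?thesis
  proof (intro conjI allI impI)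
    fix q1 q2 :: "real \<Rightarrow> real"
    assume "q1 absolutely_integrable_on {0..1}" "q2 absolutely_integrable_on {0..1}"
      "\<forall>t\<in>{0<..<1}. \<forall>r\<in>{0..eps0}. first_eigenvalue_function w q1 t r = first_eigenvalue_function w q2 t r"
    then show "AE x\<in>{0..1} in lebesgue. q1 x = q2 x"
      using assms(3) by (intro potential_determined[OF E E assms(3)]) auto
  next
    fix q :: "real \<Rightarrow> real"
    assume "q absolutely_integrable_on {0..1}"
    then interpret weighted_equation q w by (rule E)
    show "let lam1 = first_dirichlet_eigenvalue w q in
               dirichlet_eigenvalue w q lam1 \<and>
               (\<forall>\<mu>. dirichlet_eigenvalue w q \<mu> \<longrightarrow> lam1 \<le> \<mu>) \<and>
               (\<forall>t\<in>{0<..<1}. first_eigenvalue_function w q t 0 = lam1) \<and>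
               (\<forall>x\<in>{0<..<1}.
                  ((\<lambda>r. first_eigenvalue_function w q x r) has_real_derivative
                     first_eigenvalue_r_deriv w q x) (at_right 0) \<and>
                  first_eigenvalue_r_deriv w q x < 0) \<and>
               (\<forall>x\<in>{0<..<1}. phi0 w q field_differentiable (at x)) \<and>
               (\<forall>a b. 0 < a \<and> b < 1 \<longrightarrow> abs_continuous_on {a..b} (deriv (phi0 w q))) \<and>
               (AE x\<in>{0<..<1} in lebesgue.
                  deriv (phi0 w q) field_differentiable (at x) \<and>
                  q x = deriv (deriv (phi0 w q)) x / phi0 w q x + lam1 * w x)"
      unfolding Let_def first_dirichlet_eigenvalue_eq
    proof (intro conjI ballI allI impI)
      fix x :: real assume x: "x \<in> {0<..<1}"
      show "((\<lambda>r. first_eigenvalue_function w q x r) has_real_derivative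
          first_eigenvalue_r_deriv w q x) (at_right 0)"
        using first_eigenvalue_function_has_derivative[of x] first_eigenvalue_r_deriv_eq[of x] x by simp
      show "phi0 w q field_differentiable (at x)"
        using phi0_has_derivative[of x] x by (auto simp: field_differentiable_def)
    next
      show "AE x\<in>{0<..<1} in lebesgue. deriv (phi0 w q) field_differentiable (at x) \<and>
          q x = deriv (deriv (phi0 w q)) x / phi0 w q x + lam1 * w x"
        by (rule potential_from_phi0)
    qed (auto intro: dirichlet_eigenvalue_lam1 lam1_le_dirichlet_eigenvalue first_eigenvalue_function_0
        first_eigenvalue_r_deriv_neg deriv_phi0_abs_continuous)
  qed
qed

end
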